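(* Let $L$ be a diassociative algebra over a field $\mathbb{F}$ and let $0\to R\to F\to L\to 0$ be a free presentation of $L$. Then $$\mathcal{H}^2(L,\mathbb{F})\cong\frac{F'\cap R}{F\lozenge R+R\lozenge F}.$$ In particular, if $L$ is finite-dimensional, then $M(L)\cong\mathcal{H}^2(L,\mathbb{F})$.
   Context: A diassociative algebra over a field $\mathbb{F}$ is an $\mathbb{F}$-vector space with two associative bilinear products $\dashv,\vdash$ satisfying $x\dashv(y\dashv z)=x\dashv(y\vdash z)$, $(x\vdash y)\dashv z=x\vdash(y\dashv z)$, $(x\dashv y)\vdash z=(x\vdash y)\vdash z$ for all $x,y,z$. For subspaces $X,Y$, $X\dashv Y$ and $X\vdash Y$ denote spans of products, and $X\lozenge Y=X\dashv Y+X\vdash Y$. $K'=K\lozenge K$; $Z(K)$ is the set of $z\in K$ with $z\dashv x=x\dashv z=z\vdash x=x\vdash z=0$ for all $x\in K$. A free presentation of $L$ is a short exact sequence $0\to R\to F\to L\to 0$ of diassociative algebras with $F$ a free diassociative algebra and $R$ regarded as an ideal of $F$. A pair $(K,M)$ of diassociative algebras is a defining pair for $L$ if $L\cong K/M$ and $M\subseteq Z(K)\cap K'$; it is maximal if $\dim K$ is maximal, and then $M$ is called the multiplier $M(L)$ of $L$ (it has zero products and is unique up to isomorphism by dimension). The field $\mathbb{F}$ is considered as a central $L$-module (zero action; $\mathbb{F}$ is regarded as having zero products). $\mathcal{Z}^2(L,\mathbb{F})$ is the space of 2-cocycles: pairs $(f_{\dashv},f_{\vdash})$ of bilinear forms $L\times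 L\to\mathbb{F}$ such that for all $i,j,k\in L$: $f_\dashv(i,j\dashv k)=f_\dashv(i,j\vdash k)$; $f_\dashv(i\vdash j,k)=f_\vdash(i,j\dashv k)$; $f_\vdash(i\dashv j,k)=f_\vdash(i\vdash j,k)$; $f_\dashv(i,j\dashv k)=f_\dashv(i\dashv j,k)$; $f_\vdash(i,j\vdash k)=f_\vdash(i\vdash j,k)$. $\mathcal{B}^2(L,\mathbb{F})$ is the space of 2-coboundaries: pairs with $f_\dashv(i,j)=-\varepsilon(i\dashv j)$, $f_\vdash(i,j)=-\varepsilon(i\vdash j)$ for some linear $\varepsilon:L\to\mathbb{F}$. $\mathcal{H}^2(L,\mathbb{F})=\mathcal{Z}^2(L,\mathbb{F})/\mathcal{B}^2(L,\mathbb{F})$. The isomorphisms are isomorphisms of vector spaces.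
   Formalization: The displayed isomorphism is proved when the quotient (F'∩R)/(F◊R+R◊F) is finite-dimensional (as it is for finite-dimensional L); for arbitrary L, H²(L,F) is shown isomorphic to the dual of that quotient, since the literal claim fails whenever the quotient is infinite-dimensional. *)

theory Defs
  imports Complex_Main "HOL-Library.Function_Algebras" "HOL-Library.Product_Plus"
begin

section \<open>Vector spaces and quotients\<close>

text \<open>
  Raw operations on a carrier. The records carry their own addition because the elements of a
  quotient are cosets, and a set type has no group structure for the type class to provide.
  Two structures are compared by their operations on the carriers only.
\<close>

record ('f, 'v) vspace =
  vcarrier :: "'v set"
  vplus :: "'v \<Rightarrow> 'v \<Rightarrow> 'v"
  vscale :: "'f \<Rightarrow> 'v \<Rightarrow> 'v"

definition vs_iso :: "('f, 'v, 'x) vspace_scheme \<Rightarrow> ('f, 'w, 'y) vspace_scheme \<Rightarrow> bool" where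
  "vs_iso V W \<longleftrightarrow> (\<exists>h. bij_betw h (vcarrier V) (vcarrier W) \<and>
     (\<forall>x\<in>vcarrier V. \<forall>y\<in>vcarrier V. h (vplus V x y) = vplus W (h x) (h y)) \<and>
     (\<forall>c. \<forall>x\<in>vcarrier V. h (vscale V c x) = vscale W c (h x)))"

text \<open>
  Finitely generated as a vector space. A nonempty set closed under addition and scaling is a
  subspace.
\<close>

definition vs_findim :: "('f, 'v, 'x) vspace_scheme \<Rightarrow> bool" where
  "vs_findim V \<longleftrightarrow> (\<exists>B. finite B \<and> B \<subseteq> vcarrier V \<and>
     (\<forall>S. S \<subseteq> vcarrier V \<and> S \<noteq> {} \<and> B \<subseteq> S \<and>
          (\<forall>x\<in>S. \<forall>y\<in>S. vplus V x y \<in> S) \<and> (\<forall>c. \<forall>x\<in>S. vscale V c x \<in> S)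
        \<longrightarrow> S = vcarrier V))"

definition subvspace :: "('f \<Rightarrow> 'v \<Rightarrow> 'v) \<Rightarrow> 'v::ab_group_add set \<Rightarrow> ('f, 'v) vspace" where
  "subvspace s V = \<lparr>vcarrier = V, vplus = (+), vscale = s\<rparr>"

definition coset :: "'v::ab_group_add set \<Rightarrow> 'v \<Rightarrow> 'v set" where
  "coset W x = {x + w |w. w \<in> W}"

text \<open>
  On cosets of a subspace \<open>W\<close> these operations are the usual ones,
  \<open>(x + W) + (y + W) = (x + y) + W\<close> and \<open>c (x + W) = c x + W\<close>. Adding \<open>W\<close> in the second one
  matters only for \<open>c = 0\<close>.
\<close>

definition quotient_space ::
    "('f \<Rightarrow> 'v \<Rightarrow> 'v) \<Rightarrow> 'v::ab_group_add set \<Rightarrow> 'v set \<Rightarrow> ('f, 'v set) vspace" where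
  "quotient_space s V W =
     \<lparr>vcarrier = coset W ` V,
      vplus = (\<lambda>A B. {a + b |a b. a \<in> A \<and> b \<in> B}),
      vscale = (\<lambda>c A. {s c a + w |a w. a \<in> A \<and> w \<in> W})\<rparr>"

definition linear_form :: "('f::field, 'v, 'x) vspace_scheme \<Rightarrow> ('v \<Rightarrow> 'f) \<Rightarrow> bool" where
  "linear_form V e \<longleftrightarrow>
     (\<forall>x\<in>vcarrier V. \<forall>y\<in>vcarrier V. e (vplus V x y) = e x + e y) \<and>
     (\<forall>c. \<forall>x\<in>vcarrier V. e (vscale V c x) = c * e x)"

text \<open>
  Functions on a carrier are represented by total functions that vanish outside the carrier.
\<close>

definition dual_space :: "('f::field, 'v, 'x) vspace_scheme \<Rightarrow> ('f, 'v \<Rightarrow> 'f) vspace" where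
  "dual_space V = subvspace (\<lambda>c e x. c * e x)
     {e. linear_form V e \<and> (\<forall>x. x \<notin> vcarrier V \<longrightarrow> e x = 0)}"


section \<open>Diassociative algebras\<close>

record ('f, 'v) dialgebra = "('f, 'v) vspace" +
  lprod :: "'v \<Rightarrow> 'v \<Rightarrow> 'v" (infixl \<open>\<stileturn>\<index>\<close> 70)
  rprod :: "'v \<Rightarrow> 'v \<Rightarrow> 'v" (infixl \<open>\<turnstile>\<index>\<close> 70)

text \<open>
  The underlying space is a subspace of an ambient vector space on the type \<open>'v\<close>, with the addition
  of that type. The products are constrained on the carrier only.
\<close>

locale diassociative_algebra =
  fixes A :: "('f::field, 'v::ab_group_add) dialgebra" (structure)
  assumes vplus_eq: "vplus A = (+)"
    and vector_space: "vector_space (vscale A)"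
    and subspace: "module.subspace (vscale A) (vcarrier A)"
    and lprod_closed: "\<lbrakk>x \<in> vcarrier A; y \<in> vcarrier A\<rbrakk> \<Longrightarrow> x \<stileturn> y \<in> vcarrier A"
    and rprod_closed: "\<lbrakk>x \<in> vcarrier A; y \<in> vcarrier A\<rbrakk> \<Longrightarrow> x \<turnstile> y \<in> vcarrier A"
    and lprod_add_left: "\<lbrakk>x \<in> vcarrier A; y \<in> vcarrier A; z \<in> vcarrier A\<rbrakk>
          \<Longrightarrow> (x + y) \<stileturn> z = x \<stileturn> z + y \<stileturn> z"
    and lprod_add_right: "\<lbrakk>x \<in> vcarrier A; y \<in> vcarrier A; z \<in> vcarrier A\<rbrakk>
          \<Longrightarrow> x \<stileturn> (y + z) = x \<stileturn> y + x \<stileturn> z"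
    and rprod_add_left: "\<lbrakk>x \<in> vcarrier A; y \<in> vcarrier A; z \<in> vcarrier A\<rbrakk>
          \<Longrightarrow> (x + y) \<turnstile> z = x \<turnstile> z + y \<turnstile> z"
    and rprod_add_right: "\<lbrakk>x \<in> vcarrier A; y \<in> vcarrier A; z \<in> vcarrier A\<rbrakk>
          \<Longrightarrow> x \<turnstile> (y + z) = x \<turnstile> y + x \<turnstile> z"
    and lprod_scale_left: "\<lbrakk>x \<in> vcarrier A; y \<in> vcarrier A\<rbrakk>
          \<Longrightarrow> vscale A c x \<stileturn> y = vscale A c (x \<stileturn> y)"
    and lprod_scale_right: "\<lbrakk>x \<in> vcarrier A; y \<in> vcarrier A\<rbrakk>
          \<Longrightarrow> x \<stileturn> vscale A c y = vscale A c (x \<stileturn> y)"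
    and rprod_scale_left: "\<lbrakk>x \<in> vcarrier A; y \<in> vcarrier A\<rbrakk>
          \<Longrightarrow> vscale A c x \<turnstile> y = vscale A c (x \<turnstile> y)"
    and rprod_scale_right: "\<lbrakk>x \<in> vcarrier A; y \<in> vcarrier A\<rbrakk>
          \<Longrightarrow> x \<turnstile> vscale A c y = vscale A c (x \<turnstile> y)"
    and lprod_assoc: "\<lbrakk>x \<in> vcarrier A; y \<in> vcarrier A; z \<in> vcarrier A\<rbrakk>
          \<Longrightarrow> (x \<stileturn> y) \<stileturn> z = x \<stileturn> (y \<stileturn> z)"
    and rprod_assoc: "\<lbrakk>x \<in> vcarrier A; y \<in> vcarrier A; z \<in> vcarrier A\<rbrakk>
          \<Longrightarrow> (x \<turnstile> y) \<turnstile> z = x \<turnstile> (y \<turnstile> z)"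
    and lprod_inner: "\<lbrakk>x \<in> vcarrier A; y \<in> vcarrier A; z \<in> vcarrier A\<rbrakk>
          \<Longrightarrow> x \<stileturn> (y \<stileturn> z) = x \<stileturn> (y \<turnstile> z)"
    and mixed_assoc: "\<lbrakk>x \<in> vcarrier A; y \<in> vcarrier A; z \<in> vcarrier A\<rbrakk>
          \<Longrightarrow> (x \<turnstile> y) \<stileturn> z = x \<turnstile> (y \<stileturn> z)"
    and rprod_inner: "\<lbrakk>x \<in> vcarrier A; y \<in> vcarrier A; z \<in> vcarrier A\<rbrakk>
          \<Longrightarrow> (x \<stileturn> y) \<turnstile> z = (x \<turnstile> y) \<turnstile> z"

definition dialg_hom :: "('f, 'v) dialgebra \<Rightarrow> ('f, 'w) dialgebra \<Rightarrow> ('v \<Rightarrow> 'w) set" where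
  "dialg_hom A B = {h. h ` vcarrier A \<subseteq> vcarrier B \<and>
     (\<forall>c. \<forall>x\<in>vcarrier A. h (vscale A c x) = vscale B c (h x)) \<and>
     (\<forall>x\<in>vcarrier A. \<forall>y\<in>vcarrier A.
        h (vplus A x y) = vplus B (h x) (h y) \<and>
        h (x \<stileturn>\<^bsub>A\<^esub> y) = h x \<stileturn>\<^bsub>B\<^esub> h y \<and>
        h (x \<turnstile>\<^bsub>A\<^esub> y) = h x \<turnstile>\<^bsub>B\<^esub> h y)}"

definition dialg_iso :: "('f, 'v) dialgebra \<Rightarrow> ('f, 'w) dialgebra \<Rightarrow> bool" where
  "dialg_iso A B \<longleftrightarrow> (\<exists>h \<in> dialg_hom A B. bij_betw h (vcarrier A) (vcarrier B))"

text \<open>The quotient by an ideal \<open>M\<close>, with \<open>(x + M) \<stileturn> (y + M) = x \<stileturn> y + M\<close> and likewise for \<open>\<turnstile>\<close>.\<close>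

definition quotient_algebra ::
    "('f, 'v::ab_group_add) dialgebra \<Rightarrow> 'v set \<Rightarrow> ('f, 'v set) dialgebra" where
  "quotient_algebra K M =
     \<lparr>vcarrier = vcarrier (quotient_space (vscale K) (vcarrier K) M),
      vplus = vplus (quotient_space (vscale K) (vcarrier K) M),
      vscale = vscale (quotient_space (vscale K) (vcarrier K) M),
      lprod = (\<lambda>X Y. {x \<stileturn>\<^bsub>K\<^esub> y + m |x y m. x \<in> X \<and> y \<in> Y \<and> m \<in> M}),
      rprod = (\<lambda>X Y. {x \<turnstile>\<^bsub>K\<^esub> y + m |x y m. x \<in> X \<and> y \<in> Y \<and> m \<in> M})\<rparr>"

definition lspan :: "('f::field, 'v::ab_group_add) dialgebra \<Rightarrow> 'v set \<Rightarrow> 'v set \<Rightarrow> 'v set" where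
  "lspan A X Y = module.span (vscale A) {x \<stileturn>\<^bsub>A\<^esub> y |x y. x \<in> X \<and> y \<in> Y}"

definition rspan :: "('f::field, 'v::ab_group_add) dialgebra \<Rightarrow> 'v set \<Rightarrow> 'v set \<Rightarrow> 'v set" where
  "rspan A X Y = module.span (vscale A) {x \<turnstile>\<^bsub>A\<^esub> y |x y. x \<in> X \<and> y \<in> Y}"

definition subspace_sum :: "'v::ab_group_add set \<Rightarrow> 'v set \<Rightarrow> 'v set" where
  "subspace_sum X Y = {x + y |x y. x \<in> X \<and> y \<in> Y}"

text \<open>\<open>lozenge A X Y\<close> is \<open>X \<lozenge> Y\<close> computed in \<open>A\<close>.\<close>

definition lozenge :: "('f::field, 'v::ab_group_add) dialgebra \<Rightarrow> 'v set \<Rightarrow> 'v set \<Rightarrow> 'v set" where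
  "lozenge A X Y = subspace_sum (lspan A X Y) (rspan A X Y)"

definition derived :: "('f::field, 'v::ab_group_add) dialgebra \<Rightarrow> 'v set" where
  "derived A = lozenge A (vcarrier A) (vcarrier A)"

definition center :: "('f::field, 'v::ab_group_add) dialgebra \<Rightarrow> 'v set" where
  "center A = {z \<in> vcarrier A. \<forall>x\<in>vcarrier A.
     z \<stileturn>\<^bsub>A\<^esub> x = 0 \<and> x \<stileturn>\<^bsub>A\<^esub> z = 0 \<and> z \<turnstile>\<^bsub>A\<^esub> x = 0 \<and> x \<turnstile>\<^bsub>A\<^esub> z = 0}"


section \<open>Free algebras and free presentations\<close>

text \<open>
  The universal property of the free diassociative algebra on \<open>X\<close>. A definition cannot quantify
  over all types, so the test algebras \<open>B\<close> live on functions from words over \<open>'v\<close> with one marked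
  letter to the field. This loses nothing: the marked words form a basis of the free diassociative
  algebra, so this type contains a copy of the free diassociative algebra on \<open>X\<close>, a copy of \<open>A\<close>,
  and a copy of every diassociative algebra generated by an image of \<open>X\<close>.
\<close>

definition free_on :: "('f::field, 'v::ab_group_add) dialgebra \<Rightarrow> 'v set \<Rightarrow> bool" where
  "free_on A X \<longleftrightarrow> X \<subseteq> vcarrier A \<and>
     (\<forall>(B :: ('f, 'v list \<times> 'v \<times> 'v list \<Rightarrow> 'f) dialgebra) \<phi>.
        diassociative_algebra B \<and> \<phi> ` X \<subseteq> vcarrier B \<longrightarrow>
        (\<exists>h \<in> dialg_hom A B. (\<forall>x\<in>X. h x = \<phi> x) \<and>
           (\<forall>g \<in> dialg_hom A B. (\<forall>x\<in>X. g x = \<phi> x) \<longrightarrow> (\<forall>a\<in>vcarrier A. g a = h a))))"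

definition free_dialgebra :: "('f::field, 'v::ab_group_add) dialgebra \<Rightarrow> bool" where
  "free_dialgebra A \<longleftrightarrow> diassociative_algebra A \<and> (\<exists>X. free_on A X)"

text \<open>Exactness of \<open>0 \<rightarrow> R \<rightarrow> F \<rightarrow> L \<rightarrow> 0\<close>, where \<open>R\<close> is an ideal of \<open>F\<close> and \<open>p : F \<rightarrow> L\<close>.\<close>

definition free_presentation ::
    "'a set \<Rightarrow> ('f::field, 'a::ab_group_add) dialgebra \<Rightarrow> ('a \<Rightarrow> 'l) \<Rightarrow>
     ('f, 'l::ab_group_add) dialgebra \<Rightarrow> bool" where
  "free_presentation R F p L \<longleftrightarrow>
     free_dialgebra F \<and> diassociative_algebra L \<and> p \<in> dialg_hom F L \<and>
     p ` vcarrier F = vcarrier L \<and> R = {x \<in> vcarrier F. p x = 0}"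


section \<open>Defining pairs and multipliers\<close>

definition defining_pair ::
    "('f::field, 'l::ab_group_add) dialgebra \<Rightarrow> ('f, 'k::ab_group_add) dialgebra \<Rightarrow> 'k set \<Rightarrow> bool"
  where
  "defining_pair L K M \<longleftrightarrow>
     diassociative_algebra K \<and> module.subspace (vscale K) M \<and>
     M \<subseteq> center K \<inter> derived K \<and> dialg_iso L (quotient_algebra K M)"

text \<open>
  To be used for finite-dimensional \<open>L\<close>. Then \<open>dim K \<le> n + 2 n\<^sup>2\<close> for \<open>n = dim L\<close> and every
  defining pair \<open>(K, M)\<close>, so \<open>K\<close> has a copy inside \<open>nat \<Rightarrow> 'f\<close>, and it is enough to compare with the
  pairs there. The library's \<open>dim\<close> is the true dimension for all spaces involved.
\<close>

definition maximal_defining_pair ::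
    "('f::field, 'l::ab_group_add) dialgebra \<Rightarrow> ('f, 'k::ab_group_add) dialgebra \<Rightarrow> 'k set \<Rightarrow> bool"
  where
  "maximal_defining_pair L K M \<longleftrightarrow> defining_pair L K M \<and>
     (\<forall>(K' :: ('f, nat \<Rightarrow> 'f) dialgebra) M'. defining_pair L K' M' \<longrightarrow>
        vector_space.dim (vscale K') (vcarrier K') \<le> vector_space.dim (vscale K) (vcarrier K))"


section \<open>Second cohomology with coefficients in the field\<close>

definition bilinear_form_on ::
    "('f::field, 'v::ab_group_add) dialgebra \<Rightarrow> ('v \<Rightarrow> 'v \<Rightarrow> 'f) \<Rightarrow> bool" where
  "bilinear_form_on A f \<longleftrightarrow>
     (\<forall>x\<in>vcarrier A. linear_form A (f x) \<and> linear_form A (\<lambda>y. f y x)) \<and>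
     (\<forall>x y. x \<notin> vcarrier A \<or> y \<notin> vcarrier A \<longrightarrow> f x y = 0)"

definition cocycles2 ::
    "('f::field, 'v::ab_group_add) dialgebra \<Rightarrow> (('v \<Rightarrow> 'v \<Rightarrow> 'f) \<times> ('v \<Rightarrow> 'v \<Rightarrow> 'f)) set" where
  "cocycles2 L = {(f, g). bilinear_form_on L f \<and> bilinear_form_on L g \<and>
     (\<forall>i\<in>vcarrier L. \<forall>j\<in>vcarrier L. \<forall>k\<in>vcarrier L.
        f i (j \<stileturn>\<^bsub>L\<^esub> k) = f i (j \<turnstile>\<^bsub>L\<^esub> k) \<and>
        f (i \<turnstile>\<^bsub>L\<^esub> j) k = g i (j \<stileturn>\<^bsub>L\<^esub> k) \<and>
        g (i \<stileturn>\<^bsub>L\<^esub> j) k = g (i \<turnstile>\<^bsub>L\<^esub> j) k \<and>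
        f i (j \<stileturn>\<^bsub>L\<^esub> k) = f (i \<stileturn>\<^bsub>L\<^esub> j) k \<and>
        g i (j \<turnstile>\<^bsub>L\<^esub> k) = g (i \<turnstile>\<^bsub>L\<^esub> j) k)}"

definition coboundaries2 ::
    "('f::field, 'v::ab_group_add) dialgebra \<Rightarrow> (('v \<Rightarrow> 'v \<Rightarrow> 'f) \<times> ('v \<Rightarrow> 'v \<Rightarrow> 'f)) set" where
  "coboundaries2 L = {(f, g). bilinear_form_on L f \<and> bilinear_form_on L g \<and>
     (\<exists>e. linear_form L e \<and> (\<forall>i\<in>vcarrier L. \<forall>j\<in>vcarrier L.
        f i j = - e (i \<stileturn>\<^bsub>L\<^esub> j) \<and> g i j = - e (i \<turnstile>\<^bsub>L\<^esub> j)))}"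

definition H2 ::
    "('f::field, 'v::ab_group_add) dialgebra \<Rightarrow>
     ('f, (('v \<Rightarrow> 'v \<Rightarrow> 'f) \<times> ('v \<Rightarrow> 'v \<Rightarrow> 'f)) set) vspace" where
  "H2 L = quotient_space (\<lambda>c (f, g). (\<lambda>i j. c * f i j, \<lambda>i j. c * g i j))
     (cocycles2 L) (coboundaries2 L)"

text \<open>\<open>(F' \<inter> R) / (F \<lozenge> R + R \<lozenge> F)\<close>\<close>

definition hopf_quotient ::
    "('f::field, 'a::ab_group_add) dialgebra \<Rightarrow> 'a set \<Rightarrow> ('f, 'a set) vspace" where
  "hopf_quotient F R = quotient_space (vscale F) (derived F \<inter> R)
     (subspace_sum (lozenge F (vcarrier F) R) (lozenge F R (vcarrier F)))"

end

theory Submission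
  imports Defs
begin

text \<open>
  Write \<open>N = F' \<inter> R\<close> and \<open>W = F \<lozenge> R + R \<lozenge> F\<close>. A pair of bilinear forms \<open>(f, g)\<close> on \<open>L\<close> is a cocycle
  exactly if there is a linear form \<open>\<tau>\<close> on \<open>F\<close> with \<open>\<tau>(x \<stileturn> y) = f(p x, p y)\<close> and
  \<open>\<tau>(x \<turnstile> y) = g(p x, p y)\<close>: lift \<open>p\<close> to the central extension of \<open>L\<close> by the cocycle. Such a \<open>\<tau>\<close> is
  determined on \<open>F'\<close>, vanishes on \<open>W\<close>, and vanishes on \<open>N\<close> exactly if the cocycle is a coboundary;
  conversely every linear form on \<open>F\<close> that vanishes on \<open>W\<close> comes from a cocycle. Restriction of
  \<open>\<tau>\<close> to \<open>N\<close> is therefore an isomorphism from \<open>H\<^sup>2(L)\<close> to the dual of \<open>N / W\<close>.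

  If \<open>L\<close> is finite-dimensional, then \<open>F' / W\<close> is spanned by the products of lifts of a basis of
  \<open>L\<close>. For a defining pair \<open>(K, M)\<close>, a lift \<open>\<sigma>: F \<rightarrow> K\<close> of \<open>p\<close> maps \<open>N\<close> onto \<open>M\<close> and kills \<open>W\<close>, so
  \<open>dim M \<le> dim (N / W)\<close>. Equality holds for \<open>K = F / S\<close>, where \<open>S / W\<close> is a complement of \<open>N / W\<close> in
  \<open>R / W\<close>.

  The universal property speaks about one type of test algebras only. It extends to algebras on
  every type, because the subalgebra generated by an image of the generators is spanned by values of
  marked words and so has a copy on the test type.
\<close>

section \<open>Linear algebra\<close>

definition fun_scale :: "'f::field \<Rightarrow> ('i \<Rightarrow> 'f) \<Rightarrow> 'i \<Rightarrow> 'f" where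
  "fun_scale c f = (\<lambda>i. c * f i)"

definition prod_scale ::
    "('f \<Rightarrow> 'v \<Rightarrow> 'v) \<Rightarrow> ('f \<Rightarrow> 'w \<Rightarrow> 'w) \<Rightarrow> 'f \<Rightarrow> 'v \<times> 'w \<Rightarrow> 'v \<times> 'w" where
  "prod_scale s t c x = (s c (fst x), t c (snd x))"

lemma vector_space_mult: "vector_space ((*) :: 'f::field \<Rightarrow> 'f \<Rightarrow> 'f)"
  by unfold_locales (simp_all add: algebra_simps)

lemma vector_space_fun_scale: "vector_space (fun_scale :: 'f::field \<Rightarrow> ('i \<Rightarrow> 'f) \<Rightarrow> 'i \<Rightarrow> 'f)"
  by unfold_locales (simp_all add: fun_scale_def fun_eq_iff algebra_simps)

lemma vector_space_prod_scale:
  fixes s :: "'f::field \<Rightarrow> 'v::ab_group_add \<Rightarrow> 'v" and t :: "'f \<Rightarrow> 'w::ab_group_add \<Rightarrow> 'w"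
  assumes "vector_space s" "vector_space t"
  shows "vector_space (prod_scale s t)"
proof -
  interpret s: vector_space s by fact
  interpret t: vector_space t by fact
  show ?thesis
    by unfold_locales
      (auto simp: prod_scale_def s.scale_right_distrib t.scale_right_distrib
        s.scale_left_distrib t.scale_left_distrib)
qed

section \<open>Complements and coordinates inside one vector space\<close>

context vector_space
begin

text \<open>The coordinates of \<open>x\<close> over the basis \<open>B\<close> are supported in
  \<open>A\<close> and also in \<open>B - A\<close>, hence nowhere.\<close>

lemma span_Int_complement_eq_0:
  assumes "independent B" "A \<subseteq> B" "x \<in> span A" "x \<in> span (B - A)"
  shows "x = 0"
proof -
  have "representation B x = representation A x" "representation B x = representation (B - A) x"
    using assms by (auto intro!: representation_extend)
  then have "representation B x b = 0" for b
    using representation_ne_zero[of A x b] representation_ne_zero[of "B - A" x b] by auto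
  moreover have "x \<in> span B"
    using assms span_mono by blast
  ultimately show ?thesis
    using sum_nonzero_representation_eq[of B x] assms(1) by simp
qed

text \<open>Extend a basis \<open>A\<close> of \<open>W\<close> to a basis \<open>B\<close> of
  \<open>N\<close>, and let \<open>g\<close> kill \<open>A\<close> and fix \<open>B - A\<close>. The
  range of \<open>g\<close> is then a complement of \<open>W\<close> in \<open>N\<close>, so
  \<open>N / W\<close> is modelled by a subspace of the original type instead of a set of
  cosets.\<close>

lemma exists_linear_with_kernel:
  assumes W: "subspace W" and N: "subspace N" and "W \<subseteq> N"
  obtains g where "Vector_Spaces.linear scale scale g" "g ` N = range g" "{x \<in> N. g x = 0} = W"
proof -
  interpret vector_space_pair scale scale
    by unfold_locales
  obtain A where A: "A \<subseteq> W" "independent A" "W \<subseteq> span A"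
    using maximal_independent_subset by blast
  obtain B where B: "A \<subseteq> B" "B \<subseteq> N" "independent B" "N \<subseteq> span B"
    using maximal_independent_subset_extend[of A N] A \<open>W \<subseteq> N\<close> by blast
  obtain g where g: "Vector_Spaces.linear scale scale g" "\<And>x. x \<in> B \<Longrightarrow> g x = (if x \<in> A then 0 else x)"
      and range: "range g = span ((\<lambda>x. if x \<in> A then 0 else x) ` B)"
    using linear_independent_extend_subspace[OF B(3), of "\<lambda>x. if x \<in> A then 0 else x"] by blast
  interpret g: Vector_Spaces.linear scale scale g by fact
  have sN: "N = span B"
    using B(2,4) N span_minimal by blast
  have "range g = span (g ` B)"
    unfolding range by (rule arg_cong[of _ _ span]) (auto simp: g(2))
  then have gN: "g ` N = range g"
    by (simp add: g.span_image sN)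
  have g0: "g x = 0" if "x \<in> span A" for x
    using that by (rule g.eq_0_on_span[rotated]) (use B(1) g(2) in auto)
  moreover have "x \<in> W" if x: "x \<in> N" "g x = 0" for x
  proof -
    \<comment> \<open>Of the two summands of \<open>x\<close>, \<open>g\<close> kills the one over
      \<open>A\<close> and fixes the one over \<open>B - A\<close>; so \<open>g x = 0\<close> leaves
      only the first.\<close>
    have "x \<in> span (A \<union> (B - A))"
      using x(1) sN B(1) by (simp add: Un_absorb1)
    then obtain y z where yz: "x = y + z" "y \<in> span A" "z \<in> span (B - A)"
      unfolding span_Un by blast
    have "g z = z"
      using yz(3) by (rule linear_eq_on[OF g(1) linear_ident]) (auto simp: g(2))
    with x(2) yz(1) g0[OF yz(2)] have "z = 0"
      by (simp add: g.add)
    with yz show ?thesis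
      using A(1) W span_minimal by auto
  qed
  ultimately show thesis
    using that[OF g(1)] gN A(3) \<open>W \<subseteq> N\<close> by blast
qed

text \<open>Coordinates at the members of a spanning family embed \<open>V\<close> into the
  functions on the index type. This produces copies of algebras on prescribed types: functions on
  marked words for \<open>free_on\<close>, sequences for
  \<open>maximal_defining_pair\<close>.\<close>

lemma exists_coordinates:
  fixes \<phi> :: "'i \<Rightarrow> 'b"
  assumes "V \<subseteq> span (range \<phi>)"
  obtains g where "Vector_Spaces.linear scale (fun_scale :: 'a \<Rightarrow> ('i \<Rightarrow> 'a) \<Rightarrow> _) g" "inj_on g V"
proof -
  interpret F: vector_space "fun_scale :: 'a \<Rightarrow> ('i \<Rightarrow> 'a) \<Rightarrow> _"
    by (rule vector_space_fun_scale)
  obtain B where B: "B \<subseteq> range \<phi>" "independent B" "range \<phi> \<subseteq> span B"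
    using maximal_independent_subset by blast
  \<comment> \<open>A basis of the whole space makes the coordinate map linear everywhere and not
    only on \<open>V\<close>.\<close>
  let ?E = "extend_basis B"
  have E: "independent ?E" "span ?E = UNIV"
    using B(2) by (auto simp: independent_extend_basis)
  let ?g = "\<lambda>x i. representation ?E x (\<phi> i)"
  have rep: "representation ?E x = representation B x" if "x \<in> span B" for x
    using that E(1) extend_basis_superset[OF B(2)] by (intro representation_extend) auto
  have "x = y" if "x \<in> span B" "y \<in> span B" "?g x = ?g y" for x y
  proof -
    have "representation B x b = representation B y b" for b
    proof (cases "b \<in> B")
      case True
      then obtain i where "b = \<phi> i"
        using B(1) by blast
      with that show ?thesis
        by (metis rep)
    next
      case False
      then show ?thesis
        by (metis representation_ne_zero)
    qed
    then have "representation B x = representation B y"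
      by (rule ext)
    then show ?thesis
      using sum_nonzero_representation_eq[OF B(2)] that(1,2) by metis
  qed
  moreover have "V \<subseteq> span B"
    using assms B(3) span_minimal[OF B(3)] by auto
  ultimately have "inj_on ?g V"
    by (auto simp: inj_on_def)
  moreover have "Vector_Spaces.linear scale (fun_scale :: 'a \<Rightarrow> ('i \<Rightarrow> 'a) \<Rightarrow> _) ?g"
    unfolding Vector_Spaces.linear_iff
    using E by (auto simp: vector_space_axioms F.vector_space_axioms fun_eq_iff fun_scale_def
        representation_add representation_scale)
  ultimately show thesis
    using that by blast
qed

end

section \<open>Extension of linear maps from subspaces, and rank-nullity\<close>

context vector_space_pair
begin

text \<open>Extend the values of \<open>f\<close> on a basis of \<open>S\<close>. Maps that are
  linear only on a carrier can so be replaced by maps that are linear on the whole type, to which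
  the theory of \<open>Vector_Spaces.linear\<close> applies.\<close>

lemma linear_extend_subspace:
  assumes S: "vs1.subspace S"
    and add: "\<And>x y. x \<in> S \<Longrightarrow> y \<in> S \<Longrightarrow> f (x + y) = f x + f y"
    and scale: "\<And>c x. x \<in> S \<Longrightarrow> f (s1 c x) = s2 c (f x)"
  obtains g where "Vector_Spaces.linear s1 s2 g" "\<And>x. x \<in> S \<Longrightarrow> g x = f x"
proof -
  obtain B where B: "B \<subseteq> S" "vs1.independent B" "S \<subseteq> vs1.span B"
    using vs1.maximal_independent_subset by blast
  obtain g where g: "Vector_Spaces.linear s1 s2 g" "\<And>x. x \<in> B \<Longrightarrow> g x = f x"
    using linear_independent_extend[OF B(2)] by blast
  interpret g: Vector_Spaces.linear s1 s2 g by fact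
  have f0: "f 0 = 0"
    using scale[OF vs1.subspace_0[OF S], of 0] by simp
  have "x \<in> S \<and> g x = f x" if "x \<in> vs1.span B" for x
    using that
  proof (induction rule: vs1.span_induct_alt)
    case base
    then show ?case using S by (simp add: f0 g.zero vs1.subspace_0)
  next
    case (step c x y)
    then show ?case
      using B(1) S by (auto simp: g.add g.scale g(2) add scale vs1.subspace_add vs1.subspace_scale)
  qed
  with g(1) B(3) that show thesis by blast
qed

text \<open>Rank-nullity for the restriction of \<open>q\<close> to \<open>V\<close>: a basis
  \<open>A\<close> of the kernel extends to a basis \<open>B\<close> of \<open>V\<close>, and
  \<open>q\<close> maps \<open>B - A\<close> bijectively onto a basis of the image.\<close>

lemma dim_eq_kernel_plus_image:
  assumes q: "Vector_Spaces.linear s1 s2 q" and V: "vs1.subspace V"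
    and fin: "finite T" "V \<subseteq> vs1.span T"
  shows "vs1.dim V = vs1.dim {x \<in> V. q x = 0} + vs2.dim (q ` V)"
proof -
  interpret q: Vector_Spaces.linear s1 s2 q by fact
  let ?M = "{x \<in> V. q x = 0}"
  obtain A where A: "A \<subseteq> ?M" "vs1.independent A" "?M \<subseteq> vs1.span A" "card A = vs1.dim ?M"
    using vs1.basis_exists by blast
  obtain B where B: "A \<subseteq> B" "B \<subseteq> V" "vs1.independent B" "V \<subseteq> vs1.span B"
    using vs1.maximal_independent_subset_extend[of A V] A by blast
  have finB: "finite B"
    using vs1.independent_span_bound[OF fin(1) B(3)] B(2) fin(2) by blast
  have dimV: "vs1.dim V = card B"
    using B vs1.basis_card_eq_dim by metis
  have spans: "x = 0" if "x \<in> vs1.span A" "x \<in> vs1.span (B - A)" for x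
    by (rule vs1.span_Int_complement_eq_0[OF B(3,1) that])
  have sub: "vs1.span (B - A) \<subseteq> V"
    using B(2) V by (intro vs1.span_minimal) auto
  have inj: "inj_on q (vs1.span (B - A))"
    unfolding q.inj_on_iff_eq_0[OF vs1.subspace_span] using spans A(3) sub by blast
  have ind: "vs2.independent (q ` (B - A))"
    by (rule linear_independent_injective_image[OF q vs1.independent_mono[OF B(3)] inj]) auto
  have "q ` V = q ` vs1.span B"
    using B(2,4) V vs1.span_minimal by blast
  also have "\<dots> = vs2.span (q ` A \<union> q ` (B - A))"
    using B(1) by (simp add: q.span_image[symmetric] image_Un[symmetric] Un_absorb1)
  also have "\<dots> \<subseteq> vs2.span (q ` (B - A))"
    using A(1) by (intro vs2.span_minimal) (auto simp: vs2.span_base vs2.span_zero)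
  finally have span: "q ` V \<subseteq> vs2.span (q ` (B - A))" .
  have "card (q ` (B - A)) = vs2.dim (q ` V)"
    by (rule vs2.basis_card_eq_dim[OF _ span ind]) (use B(2) in auto)
  moreover have "card (q ` (B - A)) = card (B - A)"
    by (rule card_image[OF inj_on_subset[OF inj vs1.span_superset]])
  moreover have "card B = card A + card (B - A)"
    using B(1) finB by (simp add: card_Diff_subset card_mono finite_subset)
  ultimately show ?thesis
    using dimV A(4) by simp
qed

end

section \<open>Isomorphisms of vector spaces and quotients\<close>

lemma vs_isoI:
  assumes "bij_betw h (vcarrier V) (vcarrier W)"
    "\<And>x y. x \<in> vcarrier V \<Longrightarrow> y \<in> vcarrier V \<Longrightarrow> h (vplus V x y) = vplus W (h x) (h y)"
    "\<And>c x. x \<in> vcarrier V \<Longrightarrow> h (vscale V c x) = vscale W c (h x)"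
  shows "vs_iso V W"
  using assms unfolding vs_iso_def by blast

lemma vs_isoE:
  assumes "vs_iso V W"
  obtains h where "bij_betw h (vcarrier V) (vcarrier W)"
    "\<And>x y. x \<in> vcarrier V \<Longrightarrow> y \<in> vcarrier V \<Longrightarrow> h (vplus V x y) = vplus W (h x) (h y)"
    "\<And>c x. x \<in> vcarrier V \<Longrightarrow> h (vscale V c x) = vscale W c (h x)"
  using assms unfolding vs_iso_def by blast

text \<open>Neither the record nor \<open>vs_iso\<close> forces the operations to stay in the
  carrier. Closure of the source is what makes the inverse of an isomorphism respect the
  operations.\<close>

definition vs_closed :: "('f, 'v, 'x) vspace_scheme \<Rightarrow> bool" where
  "vs_closed V \<longleftrightarrow> (\<forall>x\<in>vcarrier V. \<forall>y\<in>vcarrier V. vplus V x y \<in> vcarrier V) \<and>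
     (\<forall>c. \<forall>x\<in>vcarrier V. vscale V c x \<in> vcarrier V)"

lemma vs_iso_trans:
  assumes "vs_iso U V" "vs_iso V W"
  shows "vs_iso U W"
proof -
  obtain g where g: "bij_betw g (vcarrier U) (vcarrier V)"
    "\<And>x y. x \<in> vcarrier U \<Longrightarrow> y \<in> vcarrier U \<Longrightarrow> g (vplus U x y) = vplus V (g x) (g y)"
    "\<And>c x. x \<in> vcarrier U \<Longrightarrow> g (vscale U c x) = vscale V c (g x)"
    by (rule vs_isoE[OF assms(1)]) (rule that)
  obtain h where h: "bij_betw h (vcarrier V) (vcarrier W)"
    "\<And>x y. x \<in> vcarrier V \<Longrightarrow> y \<in> vcarrier V \<Longrightarrow> h (vplus V x y) = vplus W (h x) (h y)"
    "\<And>c x. x \<in> vcarrier V \<Longrightarrow> h (vscale V c x) = vscale W c (h x)"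
    by (rule vs_isoE[OF assms(2)]) (rule that)
  have "g x \<in> vcarrier V" if "x \<in> vcarrier U" for x
    using that g(1) by (auto simp: bij_betw_def)
  then show ?thesis
    using g h by (intro vs_isoI[of "h \<circ> g"]) (auto intro: bij_betw_trans)
qed

lemma vs_iso_sym:
  assumes "vs_iso V W" "vs_closed V"
  shows "vs_iso W V"
proof -
  obtain h where h: "bij_betw h (vcarrier V) (vcarrier W)"
    "\<And>x y. x \<in> vcarrier V \<Longrightarrow> y \<in> vcarrier V \<Longrightarrow> h (vplus V x y) = vplus W (h x) (h y)"
    "\<And>c x. x \<in> vcarrier V \<Longrightarrow> h (vscale V c x) = vscale W c (h x)"
    by (rule vs_isoE[OF assms(1)]) (rule that)
  let ?k = "inv_into (vcarrier V) h"
  have k: "?k y \<in> vcarrier V" "h (?k y) = y" if "y \<in> vcarrier W" for y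
    using that h(1) by (auto simp: bij_betw_def inv_into_into f_inv_into_f)
  have kh: "?k (h x) = x" if "x \<in> vcarrier V" for x
    using that h(1) by (simp add: bij_betw_def)
  show ?thesis
  proof (rule vs_isoI[OF bij_betw_inv_into[OF h(1)]])
    fix x y assume xy: "x \<in> vcarrier W" "y \<in> vcarrier W"
    have "vplus W x y = h (vplus V (?k x) (?k y))"
      using xy by (simp add: h(2) k)
    then show "?k (vplus W x y) = vplus V (?k x) (?k y)"
      using xy k assms(2) by (simp add: kh vs_closed_def)
  next
    fix c x assume x: "x \<in> vcarrier W"
    have "vscale W c x = h (vscale V c (?k x))"
      using x by (simp add: h(3) k)
    then show "?k (vscale W c x) = vscale V c (?k x)"
      using x k assms(2) by (simp add: kh vs_closed_def)
  qed
qed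

text \<open>A closed subset of \<open>W\<close> that contains the image of \<open>B\<close> has a
  closed preimage in \<open>V\<close> that contains \<open>B\<close>; that preimage is all of
  \<open>V\<close>.\<close>

lemma vs_findim_iso:
  assumes "vs_iso V W" "vs_closed V" "vs_findim V"
  shows "vs_findim W"
proof -
  obtain h where h: "bij_betw h (vcarrier V) (vcarrier W)"
    "\<And>x y. x \<in> vcarrier V \<Longrightarrow> y \<in> vcarrier V \<Longrightarrow> h (vplus V x y) = vplus W (h x) (h y)"
    "\<And>c x. x \<in> vcarrier V \<Longrightarrow> h (vscale V c x) = vscale W c (h x)"
    by (rule vs_isoE[OF assms(1)]) (rule that)
  obtain B where B: "finite B" "B \<subseteq> vcarrier V"
    and gen: "\<forall>S. S \<subseteq> vcarrier V \<and> S \<noteq> {} \<and> B \<subseteq> S \<and>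
          (\<forall>x\<in>S. \<forall>y\<in>S. vplus V x y \<in> S) \<and> (\<forall>c. \<forall>x\<in>S. vscale V c x \<in> S)
        \<longrightarrow> S = vcarrier V"
    using assms(3) unfolding vs_findim_def by (elim exE conjE) (rule that)
  have "S = vcarrier W"
    if S: "S \<subseteq> vcarrier W" "S \<noteq> {}" "h ` B \<subseteq> S"
      "\<forall>x\<in>S. \<forall>y\<in>S. vplus W x y \<in> S" "\<forall>c. \<forall>x\<in>S. vscale W c x \<in> S" for S
  proof -
    have "{x \<in> vcarrier V. h x \<in> S} = vcarrier V"
    proof (rule gen[rule_format], intro conjI)
      obtain y where "y \<in> S"
        using S(2) by blast
      moreover from this obtain x where "x \<in> vcarrier V" "y = h x"
        using S(1) h(1) by (auto simp: bij_betw_def)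
      ultimately show "{x \<in> vcarrier V. h x \<in> S} \<noteq> {}"
        by blast
      show "\<forall>x\<in>{x \<in> vcarrier V. h x \<in> S}. \<forall>y\<in>{x \<in> vcarrier V. h x \<in> S}.
          vplus V x y \<in> {x \<in> vcarrier V. h x \<in> S}"
        using S(4) assms(2) by (auto simp: vs_closed_def h(2))
      show "\<forall>c. \<forall>x\<in>{x \<in> vcarrier V. h x \<in> S}. vscale V c x \<in> {x \<in> vcarrier V. h x \<in> S}"
        using S(5) assms(2) by (auto simp: vs_closed_def h(3))
    qed (use S(3) B(2) in auto)
    then have "h ` vcarrier V \<subseteq> S"
      by blast
    then show ?thesis
      using S(1) h(1) by (simp add: bij_betw_def subset_antisym)
  qed
  moreover have "h ` B \<subseteq> vcarrier W"
    using B(2) h(1) by (auto simp: bij_betw_def)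
  ultimately have "finite (h ` B) \<and> h ` B \<subseteq> vcarrier W \<and>
      (\<forall>S. S \<subseteq> vcarrier W \<and> S \<noteq> {} \<and> h ` B \<subseteq> S \<and>
          (\<forall>x\<in>S. \<forall>y\<in>S. vplus W x y \<in> S) \<and> (\<forall>c. \<forall>x\<in>S. vscale W c x \<in> S)
        \<longrightarrow> S = vcarrier W)"
    using B(1) by simp
  then show ?thesis
    unfolding vs_findim_def by (rule exI)
qed

text \<open>A nonempty closed set contains 0, as 0 times any of its members, so the sets
  \<open>S\<close> in \<open>vs_findim\<close> are exactly the subspaces between \<open>B\<close>
  and the carrier.\<close>

lemma vs_findim_iff_finite_span:
  assumes "vector_space (vscale V)" "vplus V = (+)" "module.subspace (vscale V) (vcarrier V)"
  shows "vs_findim V \<longleftrightarrow>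
    (\<exists>B. finite B \<and> B \<subseteq> vcarrier V \<and> vcarrier V = module.span (vscale V) B)"
proof -
  interpret vector_space "vscale V" by fact
  have *: "(\<forall>S. S \<subseteq> vcarrier V \<and> S \<noteq> {} \<and> B \<subseteq> S \<and>
          (\<forall>x\<in>S. \<forall>y\<in>S. vplus V x y \<in> S) \<and> (\<forall>c. \<forall>x\<in>S. vscale V c x \<in> S)
        \<longrightarrow> S = vcarrier V) \<longleftrightarrow> vcarrier V = span B" (is "?L = ?R") if B: "B \<subseteq> vcarrier V" for B
  proof
    assume L: ?L
    show ?R
    proof (rule L[rule_format, symmetric], intro conjI)
      show "span B \<subseteq> vcarrier V"
        using B assms(3) by (rule span_minimal)
      show "span B \<noteq> {}"
        using span_zero by blast
    qed (simp_all add: assms(2) span_add span_scale span_superset)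
  next
    assume R: ?R
    have "vcarrier V \<subseteq> S" if S: "S \<noteq> {}" "B \<subseteq> S" "\<forall>x\<in>S. \<forall>y\<in>S. x + y \<in> S"
        "\<forall>c. \<forall>x\<in>S. vscale V c x \<in> S" for S
    proof -
      obtain x where "x \<in> S"
        using S(1) by blast
      then have "vscale V 0 x \<in> S"
        using S(4) by blast
      then have "subspace S"
        using S by (simp add: subspace_def)
      then show ?thesis
        using R S(2) span_minimal by simp
    qed
    then show ?L
      unfolding assms(2) by (metis subset_antisym)
  qed
  show ?thesis
    unfolding vs_findim_def by (rule ex_cong1, rule conj_cong[OF refl], rule conj_cong[OF refl], rule *)
qed

section \<open>Cosets, quotient spaces and finite-dimensional duals\<close>

context vector_space
begin

lemma vs_closed_subvspace: "subspace V \<Longrightarrow> vs_closed (subvspace scale V)"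
  by (simp add: vs_closed_def subvspace_def subspace_add subspace_scale)

lemma mem_coset_iff: "y \<in> coset W x \<longleftrightarrow> y - x \<in> W"
  by (auto simp: coset_def intro: exI[of _ "y - x"])

lemma coset_eq_iff:
  assumes "subspace W"
  shows "coset W x = coset W y \<longleftrightarrow> x - y \<in> W"
proof
  assume "coset W x = coset W y"
  then show "x - y \<in> W"
    using mem_coset_iff[of x W x] mem_coset_iff[of x W y] assms by (simp add: subspace_0)
next
  assume xy: "x - y \<in> W"
  have "z - x \<in> W \<longleftrightarrow> z - y \<in> W" for z
    using subspace_add[OF assms, of "z - x" "x - y"] subspace_diff[OF assms, of "z - y" "x - y"] xy
    by auto
  then show "coset W x = coset W y"
    by (auto simp: mem_coset_iff)
qed

lemma coset_add:
  assumes "subspace W"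
  shows "{a + b |a b. a \<in> coset W x \<and> b \<in> coset W y} = coset W (x + y)"
proof (intro equalityI subsetI)
  fix z assume "z \<in> {a + b |a b. a \<in> coset W x \<and> b \<in> coset W y}"
  then obtain a b where "z = a + b" "a - x \<in> W" "b - y \<in> W"
    by (auto simp: mem_coset_iff)
  then show "z \<in> coset W (x + y)"
    using subspace_add[OF assms, of "a - x" "b - y"] by (simp add: mem_coset_iff algebra_simps)
next
  fix z assume "z \<in> coset W (x + y)"
  then have "z = x + (z - x)" "x \<in> coset W x" "z - x \<in> coset W y"
    using assms by (auto simp: mem_coset_iff algebra_simps subspace_0)
  then show "z \<in> {a + b |a b. a \<in> coset W x \<and> b \<in> coset W y}"
    by blast
qed

lemma coset_scale:
  assumes "subspace W"
  shows "{scale c a + w |a w. a \<in> coset W x \<and> w \<in> W} = coset W (scale c x)"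
proof (intro equalityI subsetI)
  fix z assume "z \<in> {scale c a + w |a w. a \<in> coset W x \<and> w \<in> W}"
  then obtain a w where "z = scale c a + w" "a - x \<in> W" "w \<in> W"
    by (auto simp: mem_coset_iff)
  moreover from this have "scale c (a - x) + w \<in> W"
    using assms by (simp add: subspace_add subspace_scale)
  ultimately show "z \<in> coset W (scale c x)"
    by (simp add: mem_coset_iff scale_right_diff_distrib algebra_simps)
next
  fix z assume "z \<in> coset W (scale c x)"
  then have "z = scale c x + (z - scale c x)" "x \<in> coset W x" "z - scale c x \<in> W"
    using assms by (auto simp: mem_coset_iff subspace_0)
  then show "z \<in> {scale c a + w |a w. a \<in> coset W x \<and> w \<in> W}"
    by blast
qed

lemma quotient_space_simps:
  assumes "subspace W"
  shows "vcarrier (quotient_space scale V W) = coset W ` V"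
    "vplus (quotient_space scale V W) (coset W x) (coset W y) = coset W (x + y)"
    "vscale (quotient_space scale V W) c (coset W x) = coset W (scale c x)"
  using coset_add[OF assms] coset_scale[OF assms] by (simp_all add: quotient_space_def)

lemma vs_closed_quotient_space:
  assumes "subspace V" "subspace W"
  shows "vs_closed (quotient_space scale V W)"
  using assms by (auto simp: vs_closed_def quotient_space_simps subspace_add subspace_scale)

text \<open>The first isomorphism theorem. The target is a bare record whose type may lack a
  subtraction, so the kernel is described by the pairs of vectors that \<open>g\<close>
  identifies.\<close>

lemma quotient_space_iso:
  assumes V: "subspace V" and W: "subspace W" and img: "g ` V = vcarrier U"
    and add: "\<And>x y. x \<in> V \<Longrightarrow> y \<in> V \<Longrightarrow> g (x + y) = vplus U (g x) (g y)"
    and scale: "\<And>c x. x \<in> V \<Longrightarrow> g (scale c x) = vscale U c (g x)"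
    and ker: "\<And>x y. x \<in> V \<Longrightarrow> y \<in> V \<Longrightarrow> g x = g y \<longleftrightarrow> x - y \<in> W"
  shows "vs_iso (quotient_space scale V W) U"
proof -
  define h where "h A = g (SOME x. x \<in> V \<and> A = coset W x)" for A
  have h: "h (coset W x) = g x" if "x \<in> V" for x
  proof -
    have "\<exists>y. y \<in> V \<and> coset W x = coset W y"
      using that by blast
    from someI_ex[OF this] show ?thesis
      unfolding h_def using ker[OF that] coset_eq_iff[OF W] by metis
  qed
  have "bij_betw h (coset W ` V) (vcarrier U)"
    unfolding bij_betw_def inj_on_def
    using img[symmetric] by (auto simp: h ker coset_eq_iff[OF W] image_image)
  then show ?thesis
    by (intro vs_isoI[of h])
      (use V in \<open>auto simp: quotient_space_simps[OF W] h add scale subspace_add subspace_scale\<close>)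
qed

text \<open>A finite-dimensional space is isomorphic to its dual: for a finite basis
  \<open>B\<close> of \<open>V\<close>, a form \<open>e\<close> goes to the vector whose coordinate
  at \<open>b\<close> is the value of \<open>e\<close> at the element of \<open>U\<close> that
  corresponds to \<open>b\<close>.\<close>

lemma dual_space_iso:
  assumes V: "subspace V" and U: "vs_iso U (subvspace scale V)" "vs_closed U"
    and fin: "finite T" "V \<subseteq> span T"
  shows "vs_iso (dual_space U) (subvspace scale V)"
proof -
  interpret D: vector_space_pair scale "(*)"
    by (intro vector_space_pair.intro vector_space_axioms vector_space_mult)
  obtain h where h: "bij_betw h (vcarrier U) V"
    "\<And>x y. x \<in> vcarrier U \<Longrightarrow> y \<in> vcarrier U \<Longrightarrow> h (vplus U x y) = h x + h y"
    "\<And>c x. x \<in> vcarrier U \<Longrightarrow> h (vscale U c x) = scale c (h x)"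
    using U(1) unfolding vs_iso_def by (auto simp: subvspace_def)
  obtain B where B: "B \<subseteq> V" "independent B" "V \<subseteq> span B"
    using maximal_independent_subset by blast
  have finB: "finite B"
    using independent_span_bound[OF fin(1) B(2)] B(1) fin(2) by blast
  have sB: "span B = V"
    using B(1,3) V span_minimal by blast
  have hV: "h x \<in> V" if "x \<in> vcarrier U" for x
    using that h(1) by (auto simp: bij_betw_def)
  let ?h' = "inv_into (vcarrier U) h"
  have h': "?h' v \<in> vcarrier U" "h (?h' v) = v" if "v \<in> V" for v
    using that h(1) by (auto simp: bij_betw_def inv_into_into f_inv_into_f)
  let ?D = "vcarrier (dual_space U)"
  let ?\<Phi> = "\<lambda>e. \<Sum>b\<in>B. scale (e (?h' b)) b"
  have D: "e \<in> ?D \<longleftrightarrow> linear_form U e \<and> (\<forall>x. x \<notin> vcarrier U \<longrightarrow> e x = 0)" for e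
    by (simp add: dual_space_def subvspace_def)
  have "inj_on ?\<Phi> ?D"
  proof (rule inj_onI)
    fix e e' assume e: "e \<in> ?D" "e' \<in> ?D" and eq: "?\<Phi> e = ?\<Phi> e'"
    have "(\<Sum>b\<in>B. scale (e (?h' b) - e' (?h' b)) b) = 0"
      using eq by (simp add: scale_left_diff_distrib sum_subtractf)
    from independentD[OF B(2) finB subset_refl this]
    have eqB: "e (?h' b) - e' (?h' b) = 0" if "b \<in> B" for b
      using that .
    \<comment> \<open>The difference of the two forms, carried over to \<open>V\<close>. It is
      additive and homogeneous on \<open>V\<close> and vanishes on \<open>B\<close>; a linear
      extension makes it vanish on the span of \<open>B\<close>.\<close>
    define d where "d v = e (?h' v) - e' (?h' v)" for v
    have "?h' (v + w) = vplus U (?h' v) (?h' w)" "?h' (scale c v) = vscale U c (?h' v)"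
      if "v \<in> V" "w \<in> V" for c v w
      using that U(2) h' V h(1)
      by (auto simp: bij_betw_def vs_closed_def h(2,3) intro!: inv_into_f_eq)
    then have d: "d (v + w) = d v + d w" "d (scale c v) = c * d v" if "v \<in> V" "w \<in> V" for c v w
      using e that h' by (simp_all add: d_def D linear_form_def algebra_simps)
    obtain g where g: "Vector_Spaces.linear scale (*) g" "\<And>v. v \<in> V \<Longrightarrow> g v = d v"
      using D.linear_extend_subspace[OF V, of d] d by metis
    interpret g: Vector_Spaces.linear scale "(*)" g by fact
    have "d v = 0" if "v \<in> V" for v
    proof -
      have "g v = 0"
        using that B(3) by (intro g.eq_0_on_span[of B v]) (use eqB g(2) B(1) in \<open>auto simp: d_def\<close>)
      with g(2)[OF that] show ?thesis
        by simp
    qed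
    then have "e x = e' x" if "x \<in> vcarrier U" for x
      using that h(1) hV by (force simp: d_def bij_betw_def)
    then show "e = e'"
      using e by (metis D ext)
  qed
  moreover have "?\<Phi> ` ?D = V"
  proof (intro equalityI subsetI)
    show "v \<in> V" if "v \<in> ?\<Phi> ` ?D" for v
      using that B(1) V by (auto intro!: subspace_sum subspace_scale)
  next
    fix v assume "v \<in> V"
    \<comment> \<open>The form whose values on \<open>B\<close> are the coordinates of
      \<open>v\<close> is the preimage of \<open>v\<close>.\<close>
    obtain \<psi> where \<psi>: "Vector_Spaces.linear scale (*) \<psi>" "\<And>b. b \<in> B \<Longrightarrow> \<psi> b = representation B v b"
      using D.linear_independent_extend[OF B(2)] by blast
    interpret \<psi>: Vector_Spaces.linear scale "(*)" \<psi> by fact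
    define e where "e x = (if x \<in> vcarrier U then \<psi> (h x) else 0)" for x
    have "e \<in> ?D"
      using U(2) by (auto simp: D e_def linear_form_def vs_closed_def h \<psi>.add \<psi>.scale)
    moreover have "?\<Phi> e = (\<Sum>b\<in>B. scale (representation B v b) b)"
      using B(1) by (intro sum.cong) (auto simp: e_def h' \<psi>(2) subset_iff)
    then have "?\<Phi> e = v"
      using sum_representation_eq[OF B(2) _ finB subset_refl] \<open>v \<in> V\<close> sB by simp
    ultimately show "v \<in> ?\<Phi> ` ?D"
      by blast
  qed
  ultimately have "bij_betw ?\<Phi> ?D V"
    by (simp add: bij_betw_def)
  then show ?thesis
    by (intro vs_isoI[of ?\<Phi>])
      (simp_all add: subvspace_def dual_space_def scale_left_distrib sum.distrib scale_sum_right)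
qed

text \<open>The finite spanning sets make \<open>dim\<close> the true dimension; an infinite basis
  would count as 0.\<close>

lemma subvspace_iso_of_dim_eq:
  fixes t :: "'a \<Rightarrow> 'w::ab_group_add \<Rightarrow> 'w"
  assumes "vector_space t" "subspace V" "module.subspace t W"
    and "finite S" "V \<subseteq> span S" "finite T" "W \<subseteq> module.span t T"
    and "dim V = vector_space.dim t W"
  shows "vs_iso (subvspace scale V) (subvspace t W)"
proof -
  interpret t: vector_space t by fact
  interpret vector_space_pair scale t ..
  obtain B where B: "B \<subseteq> V" "independent B" "V \<subseteq> span B" "card B = dim V"
    using basis_exists by blast
  obtain C where C: "C \<subseteq> W" "t.independent C" "W \<subseteq> t.span C" "card C = t.dim W"
    using t.basis_exists by blast
  have "finite B" "finite C"
    using independent_span_bound[OF assms(4) B(2)] t.independent_span_bound[OF assms(6) C(2)]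
      B(1) C(1) assms(5,7) by auto
  then obtain f where "Vector_Spaces.linear scale t f" "f ` V = W" "inj_on f V"
    using finite_basis_to_basis_subspace_isomorphism[OF assms(2,3,8) _ B _ C] by blast
  then show ?thesis
    by (intro vs_isoI[of f]) (auto simp: subvspace_def bij_betw_def Vector_Spaces.linear_iff)
qed

end

section \<open>Homomorphisms and transport of structure\<close>

sublocale diassociative_algebra \<subseteq> vs: vector_space "vscale A"
  by (rule vector_space)

lemma (in diassociative_algebra) carrier_closed:
  "0 \<in> vcarrier A"
  "x \<in> vcarrier A \<Longrightarrow> y \<in> vcarrier A \<Longrightarrow> x + y \<in> vcarrier A"
  "x \<in> vcarrier A \<Longrightarrow> y \<in> vcarrier A \<Longrightarrow> x - y \<in> vcarrier A"
  "x \<in> vcarrier A \<Longrightarrow> vscale A c x \<in> vcarrier A"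
  using subspace by (auto simp: vs.subspace_0 vs.subspace_add vs.subspace_diff vs.subspace_scale)

lemmas (in diassociative_algebra) product_simps =
  lprod_add_left lprod_add_right rprod_add_left rprod_add_right
  lprod_scale_left lprod_scale_right rprod_scale_left rprod_scale_right

lemma (in diassociative_algebra) product_zero:
  assumes "x \<in> vcarrier A"
  shows "x \<stileturn> 0 = 0" "0 \<stileturn> x = 0" "x \<turnstile> 0 = 0" "0 \<turnstile> x = 0"
  using lprod_scale_left[of x x 0] lprod_scale_right[of x x 0]
    rprod_scale_left[of x x 0] rprod_scale_right[of x x 0] assms by simp_all

lemma (in diassociative_algebra) product_diff:
  assumes "x \<in> vcarrier A" "y \<in> vcarrier A" "z \<in> vcarrier A"
  shows "(x - y) \<stileturn> z = x \<stileturn> z - y \<stileturn> z" "z \<stileturn> (x - y) = z \<stileturn> x - z \<stileturn> y"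
    "(x - y) \<turnstile> z = x \<turnstile> z - y \<turnstile> z" "z \<turnstile> (x - y) = z \<turnstile> x - z \<turnstile> y"
  using lprod_add_left[of "x - y" y z] lprod_add_right[of z "x - y" y]
    rprod_add_left[of "x - y" y z] rprod_add_right[of z "x - y" y] assms
  by (simp_all add: carrier_closed)

lemma dialg_hom_iff:
  assumes "diassociative_algebra A" "diassociative_algebra B"
  shows "h \<in> dialg_hom A B \<longleftrightarrow> (\<forall>x\<in>vcarrier A. h x \<in> vcarrier B) \<and>
     (\<forall>c. \<forall>x\<in>vcarrier A. h (vscale A c x) = vscale B c (h x)) \<and>
     (\<forall>x\<in>vcarrier A. \<forall>y\<in>vcarrier A. h (x + y) = h x + h y \<and>
        h (x \<stileturn>\<^bsub>A\<^esub> y) = h x \<stileturn>\<^bsub>B\<^esub> h y \<and> h (x \<turnstile>\<^bsub>A\<^esub> y) = h x \<turnstile>\<^bsub>B\<^esub> h y)"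
  using assms[THEN diassociative_algebra.vplus_eq] by (auto simp: dialg_hom_def)

lemma dialg_hom_cong:
  assumes "diassociative_algebra A" and eq: "\<And>x. x \<in> vcarrier A \<Longrightarrow> g x = h x"
  shows "g \<in> dialg_hom A B \<longleftrightarrow> h \<in> dialg_hom A B"
proof -
  interpret diassociative_algebra A by fact
  show ?thesis
    by (simp add: dialg_hom_def image_subset_iff eq vplus_eq carrier_closed lprod_closed rprod_closed
        cong: ball_cong)
qed

lemma dialg_hom_comp:
  assumes "diassociative_algebra A" "diassociative_algebra B" "diassociative_algebra C"
    "g \<in> dialg_hom A B" "h \<in> dialg_hom B C"
  shows "h \<circ> g \<in> dialg_hom A C"
  using assms(4,5) by (simp add: dialg_hom_iff assms(1-3))

text \<open>A homomorphism is constrained on the carrier only. Changing it elsewhere makes it linear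
  on the whole type and leaves it a homomorphism.\<close>

lemma (in diassociative_algebra) hom_linear_extension:
  assumes "diassociative_algebra B" "h \<in> dialg_hom A B"
  obtains g where "Vector_Spaces.linear (vscale A) (vscale B) g"
    "\<And>x. x \<in> vcarrier A \<Longrightarrow> g x = h x" "g \<in> dialg_hom A B"
proof -
  interpret B: diassociative_algebra B by fact
  interpret vector_space_pair "vscale A" "vscale B" ..
  obtain g where g: "Vector_Spaces.linear (vscale A) (vscale B) g"
      "\<And>x. x \<in> vcarrier A \<Longrightarrow> g x = h x"
    by (rule linear_extend_subspace[OF subspace, of h])
      (use assms in \<open>auto simp: dialg_hom_iff diassociative_algebra_axioms\<close>)
  moreover from g(2) have "g \<in> dialg_hom A B"
    using dialg_hom_cong[OF diassociative_algebra_axioms, of g h] assms(2) by blast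
  ultimately show thesis
    by (rule that)
qed

lemma (in diassociative_algebra) subalgebra:
  assumes "vs.subspace S" "S \<subseteq> vcarrier A"
    and "\<And>x y. x \<in> S \<Longrightarrow> y \<in> S \<Longrightarrow> x \<stileturn> y \<in> S" "\<And>x y. x \<in> S \<Longrightarrow> y \<in> S \<Longrightarrow> x \<turnstile> y \<in> S"
  shows "diassociative_algebra (A\<lparr>vcarrier := S\<rparr>)"
  by (rule diassociative_algebra.intro)
    (use assms in \<open>simp_all add: vplus_eq vector_space subset_iff product_simps
      lprod_assoc rprod_assoc mixed_assoc rprod_inner flip: lprod_inner\<close>)

text \<open>The image of \<open>A\<close> under \<open>\<sigma>\<close>, multiplied through chosen
  preimages. If the kernel on the carrier is an ideal, this is the quotient by that ideal on a type
  of one's choice; if \<open>\<sigma>\<close> is injective on the carrier, it is a copy of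
  \<open>A\<close>.\<close>

definition pushforward ::
    "('f \<Rightarrow> 'w \<Rightarrow> 'w) \<Rightarrow> ('v \<Rightarrow> 'w) \<Rightarrow> ('f, 'v) dialgebra \<Rightarrow> ('f, 'w::ab_group_add) dialgebra" where
  "pushforward t \<sigma> A = \<lparr>vcarrier = \<sigma> ` vcarrier A, vplus = (+), vscale = t,
     lprod = (\<lambda>v w. \<sigma> (inv_into (vcarrier A) \<sigma> v \<stileturn>\<^bsub>A\<^esub> inv_into (vcarrier A) \<sigma> w)),
     rprod = (\<lambda>v w. \<sigma> (inv_into (vcarrier A) \<sigma> v \<turnstile>\<^bsub>A\<^esub> inv_into (vcarrier A) \<sigma> w))\<rparr>"

lemma pushforward_simps [simp]:
  "vcarrier (pushforward t \<sigma> A) = \<sigma> ` vcarrier A"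
  "vplus (pushforward t \<sigma> A) = (+)"
  "vscale (pushforward t \<sigma> A) = t"
  by (simp_all add: pushforward_def)

context diassociative_algebra
begin

context
  fixes t :: "'f \<Rightarrow> 'w::ab_group_add \<Rightarrow> 'w" and \<sigma> :: "'v \<Rightarrow> 'w"
  assumes \<sigma>: "Vector_Spaces.linear (vscale A) t \<sigma>"
    and ideal: "\<And>x y. x \<in> vcarrier A \<Longrightarrow> y \<in> vcarrier A \<Longrightarrow> \<sigma> x = 0 \<Longrightarrow>
      \<sigma> (x \<stileturn> y) = 0 \<and> \<sigma> (y \<stileturn> x) = 0 \<and> \<sigma> (x \<turnstile> y) = 0 \<and> \<sigma> (y \<turnstile> x) = 0"
begin

text \<open>The chosen preimages do not matter:
  \<open>x' y' - x y = (x' - x) y' + x (y' - y)\<close> for either product, and both summands are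
  killed because the kernel is an ideal.\<close>

lemma pushforward_products:
  assumes "x \<in> vcarrier A" "y \<in> vcarrier A"
  shows "\<sigma> x \<stileturn>\<^bsub>pushforward t \<sigma> A\<^esub> \<sigma> y = \<sigma> (x \<stileturn> y)"
    "\<sigma> x \<turnstile>\<^bsub>pushforward t \<sigma> A\<^esub> \<sigma> y = \<sigma> (x \<turnstile> y)"
proof -
  interpret \<sigma>: Vector_Spaces.linear "vscale A" t \<sigma> by (rule \<sigma>)
  have kernel: "\<sigma> (x' \<stileturn> y') = \<sigma> (x \<stileturn> y) \<and> \<sigma> (x' \<turnstile> y') = \<sigma> (x \<turnstile> y)"
    if "x' \<in> vcarrier A" "y' \<in> vcarrier A" "\<sigma> x' = \<sigma> x" "\<sigma> y' = \<sigma> y" for x' y'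
  proof -
    have "x' \<stileturn> y' - x \<stileturn> y = (x' - x) \<stileturn> y' + x \<stileturn> (y' - y)"
      "x' \<turnstile> y' - x \<turnstile> y = (x' - x) \<turnstile> y' + x \<turnstile> (y' - y)"
      using that assms by (simp_all add: product_diff)
    moreover have "\<sigma> ((x' - x) \<stileturn> y' + x \<stileturn> (y' - y)) = 0" "\<sigma> ((x' - x) \<turnstile> y' + x \<turnstile> (y' - y)) = 0"
      using that assms ideal[of "x' - x" y'] ideal[of "y' - y" x]
      by (simp_all add: \<sigma>.add \<sigma>.diff carrier_closed)
    ultimately show ?thesis
      by (metis \<sigma>.diff eq_iff_diff_eq_0)
  qed
  let ?i = "\<lambda>z. inv_into (vcarrier A) \<sigma> (\<sigma> z)"
  have "\<sigma> (?i x \<stileturn> ?i y) = \<sigma> (x \<stileturn> y) \<and> \<sigma> (?i x \<turnstile> ?i y) = \<sigma> (x \<turnstile> y)"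
    using assms by (intro kernel inv_into_into f_inv_into_f imageI)
  then show "\<sigma> x \<stileturn>\<^bsub>pushforward t \<sigma> A\<^esub> \<sigma> y = \<sigma> (x \<stileturn> y)"
    "\<sigma> x \<turnstile>\<^bsub>pushforward t \<sigma> A\<^esub> \<sigma> y = \<sigma> (x \<turnstile> y)"
    by (simp_all add: pushforward_def)
qed

lemma pushforward_algebra: "diassociative_algebra (pushforward t \<sigma> A)"
proof -
  interpret \<sigma>: Vector_Spaces.linear "vscale A" t \<sigma> by (rule \<sigma>)
  note simps = pushforward_products lprod_closed rprod_closed carrier_closed
    \<sigma>.add[symmetric] \<sigma>.scale[symmetric]
  show ?thesis
  proof (rule diassociative_algebra.intro; (simp only: pushforward_simps)?; (elim imageE)?; hypsubst?)
    show "vector_space t"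
      by (rule \<sigma>.vs2.vector_space_axioms)
    show "\<sigma>.vs2.subspace (\<sigma> ` vcarrier A)"
      by (rule \<sigma>.subspace_image[OF subspace])
  qed (simp_all only: simps product_simps imageI lprod_assoc rprod_assoc mixed_assoc rprod_inner lprod_inner)
qed

lemma pushforward_hom: "\<sigma> \<in> dialg_hom A (pushforward t \<sigma> A)"
proof -
  interpret \<sigma>: Vector_Spaces.linear "vscale A" t \<sigma> by (rule \<sigma>)
  show ?thesis
    by (simp add: dialg_hom_iff diassociative_algebra_axioms pushforward_algebra
        pushforward_products \<sigma>.add \<sigma>.scale)
qed

end

text \<open>The kernel on the carrier is 0, and products with 0 are 0, so the ideal condition of the
  general case is met.\<close>

lemma pushforward_inj:
  assumes "Vector_Spaces.linear (vscale A) t \<sigma>" "inj_on \<sigma> (vcarrier A)"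
  shows "diassociative_algebra (pushforward t \<sigma> A)" "\<sigma> \<in> dialg_hom A (pushforward t \<sigma> A)"
    "inv_into (vcarrier A) \<sigma> \<in> dialg_hom (pushforward t \<sigma> A) A"
proof -
  interpret \<sigma>: Vector_Spaces.linear "vscale A" t \<sigma> by (rule assms)
  have "x = 0" if "x \<in> vcarrier A" "\<sigma> x = 0" for x
    using that inj_onD[OF assms(2), of x 0] by (simp add: carrier_closed \<sigma>.zero)
  then have ideal: "\<sigma> (x \<stileturn> y) = 0 \<and> \<sigma> (y \<stileturn> x) = 0 \<and> \<sigma> (x \<turnstile> y) = 0 \<and> \<sigma> (y \<turnstile> x) = 0"
    if "x \<in> vcarrier A" "y \<in> vcarrier A" "\<sigma> x = 0" for x y
    using that by (metis product_zero \<sigma>.zero)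
  show alg: "diassociative_algebra (pushforward t \<sigma> A)" and "\<sigma> \<in> dialg_hom A (pushforward t \<sigma> A)"
    by (rule pushforward_algebra[OF assms(1) ideal] pushforward_hom[OF assms(1) ideal]; assumption)+
  show "inv_into (vcarrier A) \<sigma> \<in> dialg_hom (pushforward t \<sigma> A) A"
    unfolding dialg_hom_iff[OF alg diassociative_algebra_axioms] pushforward_simps ball_simps
    by (simp only: inv_into_f_f[OF assms(2)] carrier_closed lprod_closed rprod_closed
        pushforward_products[OF assms(1) ideal] \<sigma>.add[symmetric] \<sigma>.scale[symmetric])
      (simp add: inv_into_f_f[OF assms(2)] carrier_closed lprod_closed rprod_closed
        pushforward_products[OF assms(1) ideal])
qed

end

section \<open>Free diassociative algebras\<close>

text \<open>
  The value of a word with marked letter, the normal form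
  \<open>x\<^sub>1 \<turnstile> (\<dots> \<turnstile> (x\<^sub>m \<turnstile> ((a \<stileturn> y\<^sub>1) \<stileturn> \<dots> \<stileturn> y\<^sub>n)))\<close> of a monomial.
\<close>

definition word_value ::
    "('f, 'v) dialgebra \<Rightarrow> ('i \<Rightarrow> 'v) \<Rightarrow> 'i list \<times> 'i \<times> 'i list \<Rightarrow> 'v" where
  "word_value A \<phi> = (\<lambda>(l, a, r).
     foldr (\<lambda>x y. \<phi> x \<turnstile>\<^bsub>A\<^esub> y) l (foldl (\<lambda>y x. y \<stileturn>\<^bsub>A\<^esub> \<phi> x) (\<phi> a) r))"

lemma word_value_simps [simp]:
  "word_value A \<phi> ([], a, []) = \<phi> a"
  "word_value A \<phi> ([], a, r @ [x]) = word_value A \<phi> ([], a, r) \<stileturn>\<^bsub>A\<^esub> \<phi> x"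
  "word_value A \<phi> (x # l, a, r) = \<phi> x \<turnstile>\<^bsub>A\<^esub> word_value A \<phi> (l, a, r)"
  by (simp_all add: word_value_def)

text \<open>The order of construction follows the normal form: all right letters are appended to the
  marked letter before any left letter is put in front.\<close>

lemma word_induct [case_names letter right left]:
  assumes "\<And>a. P ([], a, [])"
    and "\<And>a r x. P ([], a, r) \<Longrightarrow> P ([], a, r @ [x])"
    and "\<And>x l a r. P (l, a, r) \<Longrightarrow> P (x # l, a, r)"
  shows "P (w :: 'i list \<times> 'i \<times> 'i list)"
proof -
  have "P ([], a, r)" for a r
    by (induction r rule: rev_induct) (use assms in auto)
  then have "P (l, a, r)" for l a r
    by (induction l) (use assms in auto)
  then show ?thesis
    by (cases w) auto
qed

section \<open>Subalgebras spanned by the values of marked words\<close>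

context diassociative_algebra
begin

text \<open>This is the subalgebra generated by the family \<open>\<phi>\<close>; closure under the
  products is \<open>word_span_products\<close>.\<close>

definition word_span :: "('i \<Rightarrow> 'v) \<Rightarrow> 'v set" where
  "word_span \<phi> = vs.span (range (word_value A \<phi>))"

lemma subspace_word_span: "vs.subspace (word_span \<phi>)"
  by (simp add: word_span_def)

lemma word_span_induct [consumes 1, case_names subspace word]:
  assumes "u \<in> word_span \<phi>" "vs.subspace T" "\<And>w. word_value A \<phi> w \<in> T"
  shows "u \<in> T"
  using vs.span_minimal[of "range (word_value A \<phi>)" T] assms unfolding word_span_def by blast

context
  fixes \<phi> :: "'i \<Rightarrow> 'v"
  assumes \<phi>: "range \<phi> \<subseteq> vcarrier A"
begin

lemma word_value_closed: "word_value A \<phi> w \<in> vcarrier A"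
  by (induction w rule: word_induct) (use subsetD[OF \<phi> rangeI] in \<open>simp_all add: lprod_closed rprod_closed\<close>)

lemma word_span_closed: "word_span \<phi> \<subseteq> vcarrier A"
  unfolding word_span_def using subspace word_value_closed by (intro vs.span_minimal) auto

lemma word_value_in_word_span: "word_value A \<phi> w \<in> word_span \<phi>"
  unfolding word_span_def by (rule vs.span_base) simp

lemma generator_in_word_span: "\<phi> x \<in> word_span \<phi>"
  using word_value_in_word_span[of "([], x, [])"] by simp

text \<open>By \<open>mixed_assoc\<close>, right multiplication passes the left letters and appends
  a right letter to the word; left multiplication by \<open>\<turnstile>\<close> adds a left letter.
  Linearity does the rest.\<close>

lemma word_span_generator:
  assumes "u \<in> word_span \<phi>"
  shows "u \<stileturn> \<phi> x \<in> word_span \<phi>" "\<phi> x \<turnstile> u \<in> word_span \<phi>"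
proof -
  note c = word_value_closed subsetD[OF \<phi> rangeI] carrier_closed
  have lin: "vs.subspace {u \<in> vcarrier A. u \<stileturn> \<phi> x \<in> word_span \<phi> \<and> \<phi> x \<turnstile> u \<in> word_span \<phi>}"
    using subspace_word_span
    by (auto simp: vs.subspace_def product_simps product_zero c)
  have right: "word_value A \<phi> w \<stileturn> \<phi> x \<in> word_span \<phi>" for w
  proof -
    obtain l a r where w: "w = (l, a, r)" by (cases w)
    have "word_value A \<phi> (l, a, r) \<stileturn> \<phi> x = word_value A \<phi> (l, a, r @ [x])"
      by (induction l) (simp_all add: mixed_assoc c)
    then show ?thesis
      using word_value_in_word_span w by simp
  qed
  have left: "\<phi> x \<turnstile> word_value A \<phi> w \<in> word_span \<phi>" for w
    by (cases w) (metis word_value_in_word_span word_value_simps(3))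
  have "u \<in> {u \<in> vcarrier A. u \<stileturn> \<phi> x \<in> word_span \<phi> \<and> \<phi> x \<turnstile> u \<in> word_span \<phi>}"
    using assms lin by (rule word_span_induct) (simp add: right left c)
  then show "u \<stileturn> \<phi> x \<in> word_span \<phi>" "\<phi> x \<turnstile> u \<in> word_span \<phi>"
    by auto
qed

text \<open>In \<open>u \<stileturn> v\<close> and in \<open>v \<turnstile> u\<close> the mark is
  that of \<open>u\<close>, and \<open>v\<close> acts through its letters only. So \<open>v\<close>
  is taken to be a word and its letters are moved one by one into an arbitrary
  \<open>u\<close>.\<close>

lemma word_span_products:
  assumes "u \<in> word_span \<phi>" "v \<in> word_span \<phi>"
  shows "u \<stileturn> v \<in> word_span \<phi>" "v \<turnstile> u \<in> word_span \<phi>"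
proof -
  note c = word_value_closed subsetD[OF \<phi> rangeI] carrier_closed subsetD[OF word_span_closed]
  have words: "u \<stileturn> word_value A \<phi> w \<in> word_span \<phi> \<and> word_value A \<phi> w \<turnstile> u \<in> word_span \<phi>"
    if "u \<in> word_span \<phi>" for u w
    using that
  proof (induction w arbitrary: u rule: word_induct)
    case (letter a)
    then show ?case
      by (simp add: word_span_generator)
  next
    case (right a r x)
    let ?w = "word_value A \<phi> ([], a, r)"
    have "u \<stileturn> (?w \<stileturn> \<phi> x) = (u \<stileturn> ?w) \<stileturn> \<phi> x" "(?w \<stileturn> \<phi> x) \<turnstile> u = ?w \<turnstile> (\<phi> x \<turnstile> u)"
      using right.prems by (simp_all add: lprod_assoc rprod_inner rprod_assoc c)
    then show ?case
      using right by (simp add: word_span_generator)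
  next
    case (left x l a r)
    \<comment> \<open>On the right of \<open>\<stileturn>\<close> the two products agree, so the
      leading \<open>\<turnstile>\<close> of the word becomes \<open>\<stileturn>\<close> and
      associativity applies.\<close>
    have "u \<stileturn> word_value A \<phi> (x # l, a, r) = (u \<stileturn> \<phi> x) \<stileturn> word_value A \<phi> (l, a, r)"
      using left.prems by (simp add: lprod_assoc c flip: lprod_inner)
    then show ?case
      using left by (simp add: word_span_generator rprod_assoc c)
  qed
  have "vs.subspace {v \<in> vcarrier A. u \<stileturn> v \<in> word_span \<phi> \<and> v \<turnstile> u \<in> word_span \<phi>}"
    using subspace_word_span assms(1)
    by (auto simp: vs.subspace_def product_simps product_zero c)
  with assms(2) have "v \<in> {v \<in> vcarrier A. u \<stileturn> v \<in> word_span \<phi> \<and> v \<turnstile> u \<in> word_span \<phi>}"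
    by (rule word_span_induct) (simp add: words assms c)
  then show "u \<stileturn> v \<in> word_span \<phi>" "v \<turnstile> u \<in> word_span \<phi>"
    by auto
qed

lemma word_span_algebra: "diassociative_algebra (A\<lparr>vcarrier := word_span \<phi>\<rparr>)"
  by (intro subalgebra subspace_word_span word_span_closed word_span_products)

end

end

section \<open>The universal property for algebras on arbitrary types\<close>

lemma free_onD:
  fixes A :: "('f::field, 'v::ab_group_add) dialgebra"
    and B :: "('f, 'v list \<times> 'v \<times> 'v list \<Rightarrow> 'f) dialgebra"
  assumes "free_on A X" "diassociative_algebra B" "\<phi> ` X \<subseteq> vcarrier B"
  obtains h where "h \<in> dialg_hom A B" "\<forall>x\<in>X. h x = \<phi> x"
    "\<forall>g\<in>dialg_hom A B. (\<forall>x\<in>X. g x = \<phi> x) \<longrightarrow> (\<forall>a\<in>vcarrier A. g a = h a)"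
proof -
  have "\<exists>h\<in>dialg_hom A B. (\<forall>x\<in>X. h x = \<phi> x) \<and>
      (\<forall>g\<in>dialg_hom A B. (\<forall>x\<in>X. g x = \<phi> x) \<longrightarrow> (\<forall>a\<in>vcarrier A. g a = h a))"
    using assms(1) unfolding free_on_def
    by (elim conjE allE[of _ B] allE[of _ \<phi>] impE) (intro conjI assms(2,3))
  then show thesis
    using that by (elim bexE conjE)
qed

text \<open>The subalgebra of \<open>B\<close> generated by the images is spanned by a family
  indexed by marked words over \<open>'v\<close>, so coordinates copy it onto the test type. The
  homomorphism into the copy is followed by the inverse of the copying map. The location of its
  values is recorded for \<open>free_on_generated\<close>.\<close>

lemma free_on_hom_exists:
  fixes A :: "('f::field, 'v::ab_group_add) dialgebra" and B :: "('f, 'w::ab_group_add) dialgebra"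
  assumes A: "diassociative_algebra A" "free_on A X"
    and B: "diassociative_algebra B" "\<phi> ` X \<subseteq> vcarrier B"
  obtains h where "h \<in> dialg_hom A B" "\<And>x. x \<in> X \<Longrightarrow> h x = \<phi> x"
    "h ` vcarrier A \<subseteq> diassociative_algebra.word_span B (\<lambda>x. if x \<in> X then \<phi> x else 0)"
proof -
  interpret B: diassociative_algebra B by fact
  \<comment> \<open>The index type contains more than \<open>X\<close>; the value 0 elsewhere adds
    nothing to the generated subalgebra.\<close>
  define \<psi> where "\<psi> x = (if x \<in> X then \<phi> x else 0)" for x
  have \<psi>: "range \<psi> \<subseteq> vcarrier B"
    using B(2) by (auto simp: \<psi>_def B.carrier_closed)
  let ?B = "B\<lparr>vcarrier := B.word_span \<psi>\<rparr>"
  interpret B': diassociative_algebra ?B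
    by (rule B.word_span_algebra[OF \<psi>])
  obtain \<iota> where \<iota>: "Vector_Spaces.linear (vscale B) (fun_scale :: 'f \<Rightarrow> ('v list \<times> 'v \<times> 'v list \<Rightarrow> 'f) \<Rightarrow> _) \<iota>"
    "inj_on \<iota> (B.word_span \<psi>)"
    using B.vs.exists_coordinates[of "B.word_span \<psi>" "word_value B \<psi>"]
    unfolding B.word_span_def by blast
  let ?C = "pushforward fun_scale \<iota> ?B"
  have C: "diassociative_algebra ?C" "\<iota> \<in> dialg_hom ?B ?C" "inv_into (B.word_span \<psi>) \<iota> \<in> dialg_hom ?C ?B"
    using B'.pushforward_inj[of fun_scale \<iota>] \<iota> by simp_all
  have "(\<lambda>x. \<iota> (\<psi> x)) ` X \<subseteq> vcarrier ?C"
    using B.generator_in_word_span[OF \<psi>] by auto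
  then obtain h where h: "h \<in> dialg_hom A ?C" "\<And>x. x \<in> X \<Longrightarrow> h x = \<iota> (\<psi> x)"
    using free_onD[OF A(2) C(1)] by metis
  let ?k = "inv_into (B.word_span \<psi>) \<iota> \<circ> h"
  have k: "?k \<in> dialg_hom A ?B"
    by (rule dialg_hom_comp[OF A(1) C(1) B'.diassociative_algebra_axioms h(1) C(3)])
  show thesis
  proof (rule that)
    show "?k \<in> dialg_hom A B"
      using k B.word_span_closed[OF \<psi>] by (auto simp: dialg_hom_def)
    show "?k x = \<phi> x" if "x \<in> X" for x
      using that h(2) \<iota>(2) B.generator_in_word_span[OF \<psi>, of x] by (simp add: \<psi>_def)
    show "?k ` vcarrier A \<subseteq> B.word_span (\<lambda>x. if x \<in> X then \<phi> x else 0)"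
      using k by (simp add: dialg_hom_def \<psi>_def[abs_def])
  qed
qed

text \<open>The inclusion of \<open>X\<close> extends to an endomorphism \<open>h\<close> with
  values in the word span. After copying \<open>A\<close> onto the test type, uniqueness forces
  \<open>h\<close> to be the identity on \<open>A\<close>.\<close>

lemma free_on_generated:
  fixes A :: "('f::field, 'v::ab_group_add) dialgebra"
  assumes "diassociative_algebra A" "free_on A X"
  shows "vcarrier A \<subseteq> diassociative_algebra.word_span A (\<lambda>x. if x \<in> X then x else 0)"
proof -
  interpret diassociative_algebra A by fact
  have X: "X \<subseteq> vcarrier A"
    using assms(2) by (simp add: free_on_def)
  obtain h where h: "h \<in> dialg_hom A A" "\<And>x. x \<in> X \<Longrightarrow> h x = x"
    "h ` vcarrier A \<subseteq> word_span (\<lambda>x. if x \<in> X then x else 0)"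
    using free_on_hom_exists[OF assms assms(1), of "\<lambda>x. x"] X by auto
  \<comment> \<open>Taking the marked letter is a map from words onto the whole type
    \<open>'v\<close>, so words can index a spanning family of \<open>A\<close> itself.\<close>
  have "vcarrier A \<subseteq> vs.span (range (\<lambda>w :: 'v list \<times> 'v \<times> 'v list. fst (snd w)))"
    by (rule subsetI, rule vs.span_base) (metis rangeI fst_conv snd_conv)
  then obtain \<iota> where \<iota>: "Vector_Spaces.linear (vscale A) (fun_scale :: 'f \<Rightarrow> ('v list \<times> 'v \<times> 'v list \<Rightarrow> 'f) \<Rightarrow> _) \<iota>"
    "inj_on \<iota> (vcarrier A)"
    using vs.exists_coordinates by blast
  let ?C = "pushforward fun_scale \<iota> A"
  note C = pushforward_inj[OF \<iota>]
  have \<iota>h: "\<iota> \<circ> h \<in> dialg_hom A ?C"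
    using dialg_hom_comp[OF assms(1) assms(1) C(1) h(1) C(2)] .
  have "\<iota> ` X \<subseteq> vcarrier ?C"
    using X by auto
  then obtain k where "k \<in> dialg_hom A ?C" "\<forall>x\<in>X. k x = \<iota> x"
    and k: "\<forall>g\<in>dialg_hom A ?C. (\<forall>x\<in>X. g x = \<iota> x) \<longrightarrow> (\<forall>a\<in>vcarrier A. g a = k a)"
    by (rule free_onD[OF assms(2) C(1)])
  have "(\<iota> \<circ> h) a = \<iota> a" if "a \<in> vcarrier A" for a
  proof -
    have "(\<iota> \<circ> h) a = k a"
      using bspec[OF k \<iota>h] that h(2) by simp
    moreover have "\<iota> a = k a"
      using bspec[OF k C(2)] that by simp
    ultimately show ?thesis
      by simp
  qed
  moreover have "h a \<in> vcarrier A" if "a \<in> vcarrier A" for a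
    using that h(1) unfolding dialg_hom_def by blast
  ultimately have "h a = a" if "a \<in> vcarrier A" for a
    using that inj_onD[OF \<iota>(2), of "h a" a] by simp
  then have "h ` vcarrier A = vcarrier A"
    by simp
  with h(3) show ?thesis
    by simp
qed

text \<open>Uniqueness for every target type follows from generation by \<open>X\<close>: two
  homomorphisms that agree on the letters agree on all words and hence on their span.\<close>

lemma free_on_hom_unique:
  assumes A: "diassociative_algebra A" "free_on A X" and B: "diassociative_algebra B"
    and g: "g \<in> dialg_hom A B" and h: "h \<in> dialg_hom A B"
    and eq: "\<And>x. x \<in> X \<Longrightarrow> g x = h x" and a: "a \<in> vcarrier A"
  shows "g a = h a"
proof -
  interpret A: diassociative_algebra A by fact
  interpret B: diassociative_algebra B by fact
  let ?\<psi> = "\<lambda>x. if x \<in> X then x else 0"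
  have \<psi>: "range ?\<psi> \<subseteq> vcarrier A"
    using A(2) by (auto simp: free_on_def A.carrier_closed)
  note hom = g[unfolded dialg_hom_iff[OF A(1) B]] h[unfolded dialg_hom_iff[OF A(1) B]]
  have zero: "g 0 = 0" "h 0 = 0"
    using hom A.carrier_closed(1) by (metis add_cancel_right_right add_0)+
  have "A.vs.subspace {a \<in> vcarrier A. g a = h a}"
    using hom zero by (simp add: A.vs.subspace_def A.carrier_closed)
  moreover have "word_value A ?\<psi> w \<in> {a \<in> vcarrier A. g a = h a}" for w
  proof (induction w rule: word_induct)
    case (letter a)
    then show ?case
      using subsetD[OF \<psi> rangeI, of a] by (simp add: eq zero)
  next
    case (right a r x)
    moreover have "?\<psi> x \<in> vcarrier A" "g (?\<psi> x) = h (?\<psi> x)"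
      using subsetD[OF \<psi> rangeI, of x] by (simp_all add: eq zero)
    ultimately show ?case
      unfolding word_value_simps using hom by (simp add: A.lprod_closed)
  next
    case (left x l a r)
    moreover have "?\<psi> x \<in> vcarrier A" "g (?\<psi> x) = h (?\<psi> x)"
      using subsetD[OF \<psi> rangeI, of x] by (simp_all add: eq zero)
    ultimately show ?case
      unfolding word_value_simps using hom by (simp add: A.rprod_closed)
  qed
  ultimately have "a \<in> {a \<in> vcarrier A. g a = h a}"
    by (rule A.word_span_induct[OF subsetD[OF free_on_generated[OF A] a]])
  then show ?thesis
    by simp
qed

text \<open>Projectivity of free algebras: choose preimages of the \<open>p x\<close> for generators
  \<open>x\<close> and extend. The composite with \<open>q\<close> agrees with \<open>p\<close> on
  the generators, hence everywhere on \<open>F\<close>.\<close>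

lemma free_dialgebra_lift:
  assumes F: "free_dialgebra F" and K: "diassociative_algebra K" and L: "diassociative_algebra L"
    and p: "p \<in> dialg_hom F L" and q: "q \<in> dialg_hom K L" "q ` vcarrier K = vcarrier L"
  obtains h where "h \<in> dialg_hom F K" "\<And>x. x \<in> vcarrier F \<Longrightarrow> q (h x) = p x"
proof -
  obtain X where X: "diassociative_algebra F" "free_on F X"
    using F by (auto simp: free_dialgebra_def)
  have "\<exists>k\<in>vcarrier K. q k = p x" if "x \<in> X" for x
  proof -
    have "x \<in> vcarrier F"
      using that X(2) unfolding free_on_def by blast
    then have "p x \<in> vcarrier L"
      using p by (auto simp: dialg_hom_def)
    then show ?thesis
      using q(2) by (metis imageE)
  qed
  then obtain \<phi> where \<phi>: "\<And>x. x \<in> X \<Longrightarrow> \<phi> x \<in> vcarrier K" "\<And>x. x \<in> X \<Longrightarrow> q (\<phi> x) = p x"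
    by metis
  then have "\<phi> ` X \<subseteq> vcarrier K"
    by blast
  then obtain h where h: "h \<in> dialg_hom F K" "\<And>x. x \<in> X \<Longrightarrow> h x = \<phi> x"
    by (rule free_on_hom_exists[OF X K]) (rule that)
  have "(q \<circ> h) x = p x" if "x \<in> vcarrier F" for x
    by (rule free_on_hom_unique[OF X L dialg_hom_comp[OF X(1) K L h(1) q(1)] p _ that])
      (simp add: h(2) \<phi>(2))
  with h(1) that show thesis
    by simp
qed

section \<open>Cocycles and free presentations\<close>

text \<open>The central extension of \<open>L\<close> by the field; the forms \<open>f\<close> and
  \<open>g\<close> supply the second components of the two products.\<close>

definition cocycle_extension ::
    "('f::field, 'v::ab_group_add) dialgebra \<Rightarrow> ('v \<Rightarrow> 'v \<Rightarrow> 'f) \<Rightarrow> ('v \<Rightarrow> 'v \<Rightarrow> 'f) \<Rightarrow>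
     ('f, 'v \<times> 'f) dialgebra" where
  "cocycle_extension L f g = \<lparr>vcarrier = vcarrier L \<times> UNIV, vplus = (+),
     vscale = prod_scale (vscale L) (*),
     lprod = (\<lambda>x y. (fst x \<stileturn>\<^bsub>L\<^esub> fst y, f (fst x) (fst y))),
     rprod = (\<lambda>x y. (fst x \<turnstile>\<^bsub>L\<^esub> fst y, g (fst x) (fst y)))\<rparr>"

lemma linear_form_iff:
  assumes "diassociative_algebra L"
  shows "linear_form L e \<longleftrightarrow>
    (\<forall>x\<in>vcarrier L. \<forall>y\<in>vcarrier L. e (x + y) = e x + e y) \<and>
    (\<forall>c. \<forall>x\<in>vcarrier L. e (vscale L c x) = c * e x)"
  using assms[THEN diassociative_algebra.vplus_eq] by (simp add: linear_form_def)

lemma bilinear_form_on_iff: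
  assumes "diassociative_algebra L"
  shows "bilinear_form_on L f \<longleftrightarrow>
    (\<forall>x\<in>vcarrier L. \<forall>y\<in>vcarrier L. \<forall>z\<in>vcarrier L.
       f x (y + z) = f x y + f x z \<and> f (y + z) x = f y x + f z x) \<and>
    (\<forall>c. \<forall>x\<in>vcarrier L. \<forall>y\<in>vcarrier L. f x (vscale L c y) = c * f x y \<and> f (vscale L c y) x = c * f y x) \<and>
    (\<forall>x y. x \<notin> vcarrier L \<or> y \<notin> vcarrier L \<longrightarrow> f x y = 0)"
  unfolding bilinear_form_on_def linear_form_iff[OF assms] by blast

text \<open>In the first component the axioms are those of \<open>L\<close>; in the second component
  they are the five cocycle conditions.\<close>

lemma cocycle_extension_algebra:
  assumes "diassociative_algebra L" "(f, g) \<in> cocycles2 L"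
  shows "diassociative_algebra (cocycle_extension L f g)"
proof -
  interpret L: diassociative_algebra L by fact
  note bilin = assms(2)[unfolded cocycles2_def bilinear_form_on_iff[OF assms(1)], simplified]
  \<comment> \<open>The first and the fourth condition of \<open>cocycles2\<close> combined, in the
    form in which the normalised axioms call for them.\<close>
  then have assoc: "f (i \<stileturn>\<^bsub>L\<^esub> j) k = f i (j \<turnstile>\<^bsub>L\<^esub> k)"
    if "i \<in> vcarrier L" "j \<in> vcarrier L" "k \<in> vcarrier L" for i j k
    using that by metis
  have "vector_space (prod_scale (vscale L) (*))"
    by (rule vector_space_prod_scale[OF L.vector_space vector_space_mult])
  then interpret P: vector_space "prod_scale (vscale L) (*)" .
  show ?thesis
    by (rule diassociative_algebra.intro)
      (use bilin assoc in \<open>auto simp: cocycle_extension_def P.vector_space_axioms P.subspace_def prod_scale_def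
        zero_prod_def L.carrier_closed L.lprod_closed L.rprod_closed L.product_simps L.lprod_assoc
        L.rprod_assoc L.mixed_assoc L.rprod_inner simp flip: L.lprod_inner\<close>)
qed

text \<open>Elements of \<open>S\<close> with the same \<open>p\<close>-value differ by an element
  of \<open>S\<close> that \<open>p\<close> kills, so \<open>\<tau>\<close> descends to the image of
  \<open>S\<close>; from there it is extended linearly.\<close>

lemma linear_factor:
  assumes p: "Vector_Spaces.linear s1 s2 p" and \<tau>: "Vector_Spaces.linear s1 s3 \<tau>"
    and S: "module.subspace s1 S" and ker: "\<And>x. x \<in> S \<Longrightarrow> p x = 0 \<Longrightarrow> \<tau> x = 0"
  obtains \<epsilon> where "Vector_Spaces.linear s2 s3 \<epsilon>" "\<And>x. x \<in> S \<Longrightarrow> \<epsilon> (p x) = \<tau> x"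
proof -
  interpret p: Vector_Spaces.linear s1 s2 p by fact
  interpret \<tau>: Vector_Spaces.linear s1 s3 \<tau> by fact
  interpret P: vector_space_pair s2 s3 ..
  define e where "e y = \<tau> (inv_into S p y)" for y
  have e: "e (p x) = \<tau> x" if "x \<in> S" for x
  proof -
    let ?x = "inv_into S p (p x)"
    have "?x \<in> S" "p ?x = p x"
      using that by (simp_all add: inv_into_into f_inv_into_f)
    then have "\<tau> (?x - x) = 0"
      using that S by (intro ker) (simp_all add: p.diff p.vs1.subspace_diff)
    then show ?thesis
      by (simp add: e_def \<tau>.diff)
  qed
  obtain \<epsilon> where "Vector_Spaces.linear s2 s3 \<epsilon>" "\<And>y. y \<in> p ` S \<Longrightarrow> \<epsilon> y = e y"
  proof (rule P.linear_extend_subspace[of "p ` S" e])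
    show "p.vs2.subspace (p ` S)"
      by (rule p.subspace_image[OF S])
    show "e (y + z) = e y + e z" if "y \<in> p ` S" "z \<in> p ` S" for y z
      using that S by (auto simp: e \<tau>.add p.vs1.subspace_add simp flip: p.add)
    show "e (s2 c y) = s3 c (e y)" if "y \<in> p ` S" for c y
      using that S by (auto simp: e \<tau>.scale p.vs1.subspace_scale simp flip: p.scale)
  qed (rule that)
  with e that show thesis
    by simp
qed

text \<open>Linearity of \<open>p\<close> on the whole type is a normalisation:
  \<open>free_presentation_linear\<close> obtains it by changing \<open>p\<close> outside the
  carrier of \<open>F\<close>.\<close>

locale linear_free_presentation =
  fixes R :: "'a::ab_group_add set" and F :: "('f::field, 'a) dialgebra"
    and p :: "'a \<Rightarrow> 'l::ab_group_add" and L :: "('f, 'l) dialgebra"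
  assumes presentation: "free_presentation R F p L"
    and p_linear: "Vector_Spaces.linear (vscale F) (vscale L) p"
begin

lemma free: "free_dialgebra F" and p_hom: "p \<in> dialg_hom F L"
  and p_surj: "p ` vcarrier F = vcarrier L" and R_eq: "R = {x \<in> vcarrier F. p x = 0}"
  using presentation by (simp_all add: free_presentation_def)

sublocale F: diassociative_algebra F
  using free by (simp add: free_dialgebra_def)

sublocale L: diassociative_algebra L
  using presentation by (simp add: free_presentation_def)

sublocale p: Vector_Spaces.linear "vscale F" "vscale L" p
  by (rule p_linear)

lemma p_simps:
  assumes "x \<in> vcarrier F"
  shows "p x \<in> vcarrier L"
    "y \<in> vcarrier F \<Longrightarrow> p (x \<stileturn>\<^bsub>F\<^esub> y) = p x \<stileturn>\<^bsub>L\<^esub> p y"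
    "y \<in> vcarrier F \<Longrightarrow> p (x \<turnstile>\<^bsub>F\<^esub> y) = p x \<turnstile>\<^bsub>L\<^esub> p y"
  using assms p_hom
  unfolding dialg_hom_iff[OF F.diassociative_algebra_axioms L.diassociative_algebra_axioms]
  by blast+

abbreviation N :: "'a set" where
  "N \<equiv> derived F \<inter> R"

abbreviation W :: "'a set" where
  "W \<equiv> subspace_sum (lozenge F (vcarrier F) R) (lozenge F R (vcarrier F))"

end

section \<open>Spans of products and the subspaces \<open>N\<close> and \<open>W\<close>\<close>

context diassociative_algebra
begin

text \<open>Generators of \<open>lozenge A X Y\<close>. Collecting both products in one set turns a
  sum of two spans into a single span.\<close>

definition products :: "'v set \<Rightarrow> 'v set \<Rightarrow> 'v set" where
  "products X Y = {x \<stileturn> y |x y. x \<in> X \<and> y \<in> Y} \<union> {x \<turnstile> y |x y. x \<in> X \<and> y \<in> Y}"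

lemma productsI:
  assumes "x \<in> X" "y \<in> Y"
  shows "x \<stileturn> y \<in> products X Y" "x \<turnstile> y \<in> products X Y"
  using assms unfolding products_def by blast+

lemma lozenge_eq_span: "lozenge A X Y = vs.span (products X Y)"
  by (simp add: lozenge_def lspan_def rspan_def products_def subspace_sum_def vs.span_Un)

lemma lozenge_sum_eq_span:
  "subspace_sum (lozenge A X Y) (lozenge A Y X) = vs.span (products X Y \<union> products Y X)"
  by (simp add: lozenge_eq_span subspace_sum_def vs.span_Un)

lemma derived_eq_span: "derived A = vs.span (products (vcarrier A) (vcarrier A))"
  by (simp add: derived_def lozenge_eq_span)

lemma products_in_derived:
  assumes "x \<in> vcarrier A" "y \<in> vcarrier A"
  shows "x \<stileturn> y \<in> derived A" "x \<turnstile> y \<in> derived A"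
  using assms unfolding derived_eq_span by (simp_all add: vs.span_base productsI)

lemma derived_closed: "derived A \<subseteq> vcarrier A"
  unfolding derived_eq_span
  using subspace by (intro vs.span_minimal) (auto simp: products_def lprod_closed rprod_closed)

lemma subspace_derived: "vs.subspace (derived A)"
  by (simp add: derived_eq_span)

end

context linear_free_presentation
begin

lemma subspace_R: "F.vs.subspace R"
  unfolding R_eq F.vs.subspace_def by (auto simp: F.carrier_closed p.add p.scale)

lemma subspace_N: "F.vs.subspace N"
  by (intro F.vs.subspace_inter F.subspace_derived subspace_R)

lemma W_eq_span: "W = F.vs.span (F.products (vcarrier F) R \<union> F.products R (vcarrier F))"
  by (rule F.lozenge_sum_eq_span)

lemma subspace_W: "F.vs.subspace W"
  by (simp add: W_eq_span)

lemma R_subset: "R \<subseteq> vcarrier F"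
  by (auto simp: R_eq)

lemma p_R: "r \<in> R \<Longrightarrow> p r = 0"
  by (simp add: R_eq)

lemma products_R_in_W:
  assumes "x \<in> vcarrier F" "r \<in> R"
  shows "x \<stileturn>\<^bsub>F\<^esub> r \<in> W" "x \<turnstile>\<^bsub>F\<^esub> r \<in> W" "r \<stileturn>\<^bsub>F\<^esub> x \<in> W" "r \<turnstile>\<^bsub>F\<^esub> x \<in> W"
  using assms unfolding W_eq_span by (simp_all add: F.vs.span_base F.productsI)

text \<open>A product with a factor in \<open>R\<close> lies in \<open>F'\<close>, and
  \<open>p\<close> maps it to a product with 0.\<close>

lemma W_subset_N: "W \<subseteq> N"
proof -
  have "F.products (vcarrier F) R \<union> F.products R (vcarrier F) \<subseteq> N"
    using R_subset
    by (auto simp: F.products_def R_eq F.products_in_derived F.lprod_closed F.rprod_closed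
        p_simps L.product_zero)
  then show ?thesis
    unfolding W_eq_span by (rule F.vs.span_minimal[OF _ subspace_N])
qed

lemma linear_zero_on_W:
  assumes "Vector_Spaces.linear (vscale F) s \<tau>"
    and "\<And>x r. x \<in> vcarrier F \<Longrightarrow> r \<in> R \<Longrightarrow> \<tau> (x \<stileturn>\<^bsub>F\<^esub> r) = 0 \<and> \<tau> (x \<turnstile>\<^bsub>F\<^esub> r) = 0 \<and>
      \<tau> (r \<stileturn>\<^bsub>F\<^esub> x) = 0 \<and> \<tau> (r \<turnstile>\<^bsub>F\<^esub> x) = 0"
    and "w \<in> W"
  shows "\<tau> w = 0"
proof -
  interpret \<tau>: Vector_Spaces.linear "vscale F" s \<tau> by fact
  show ?thesis
    by (rule \<tau>.eq_0_on_span[OF _ assms(3)[unfolded W_eq_span]])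
      (use assms(2) in \<open>auto simp: F.products_def\<close>)
qed

lemma lift:
  assumes "diassociative_algebra K" "q \<in> dialg_hom K L" "q ` vcarrier K = vcarrier L"
  obtains \<sigma> where "Vector_Spaces.linear (vscale F) (vscale K) \<sigma>" "\<sigma> \<in> dialg_hom F K"
    "\<And>x. x \<in> vcarrier F \<Longrightarrow> q (\<sigma> x) = p x"
proof -
  obtain h where h: "h \<in> dialg_hom F K" "\<And>x. x \<in> vcarrier F \<Longrightarrow> q (h x) = p x"
    by (rule free_dialgebra_lift[OF free assms(1) L.diassociative_algebra_axioms p_hom assms(2,3)]) (rule that)
  obtain \<sigma> where \<sigma>: "Vector_Spaces.linear (vscale F) (vscale K) \<sigma>"
    "\<And>x. x \<in> vcarrier F \<Longrightarrow> \<sigma> x = h x" "\<sigma> \<in> dialg_hom F K"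
    by (rule F.hom_linear_extension[OF assms(1) h(1)]) (rule that)
  show thesis
    by (rule that[OF \<sigma>(1,3)]) (simp add: \<sigma>(2) h(2))
qed

text \<open>
  \<open>\<tau>\<close> is the second component of a homomorphism from \<open>F\<close> to the central extension of \<open>L\<close> by the
  pair \<open>fg\<close> that lifts \<open>p\<close>.
\<close>

definition splits :: "('l \<Rightarrow> 'l \<Rightarrow> 'f) \<times> ('l \<Rightarrow> 'l \<Rightarrow> 'f) \<Rightarrow> ('a \<Rightarrow> 'f) \<Rightarrow> bool" where
  "splits fg \<tau> \<longleftrightarrow> Vector_Spaces.linear (vscale F) (*) \<tau> \<and>
     (\<forall>x\<in>vcarrier F. \<forall>y\<in>vcarrier F. \<tau> (x \<stileturn>\<^bsub>F\<^esub> y) = fst fg (p x) (p y) \<and>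
        \<tau> (x \<turnstile>\<^bsub>F\<^esub> y) = snd fg (p x) (p y))"

text \<open>Lift \<open>p\<close> along the first projection of the cocycle extension; the second
  component of the lift is the required form on \<open>F\<close>.\<close>

lemma cocycle_splits:
  assumes "fg \<in> cocycles2 L"
  obtains \<tau> where "splits fg \<tau>"
proof -
  obtain f g where fg: "fg = (f, g)"
    by (cases fg)
  let ?K = "cocycle_extension L f g"
  have K: "diassociative_algebra ?K"
    using assms fg by (simp add: cocycle_extension_algebra L.diassociative_algebra_axioms)
  have "fst \<in> dialg_hom ?K L"
    unfolding dialg_hom_iff[OF K L.diassociative_algebra_axioms]
    by (auto simp: cocycle_extension_def prod_scale_def)
  moreover have "fst ` vcarrier ?K = vcarrier L"
    by (simp add: cocycle_extension_def)
  ultimately obtain \<sigma> where \<sigma>: "Vector_Spaces.linear (vscale F) (vscale ?K) \<sigma>" "\<sigma> \<in> dialg_hom F ?K"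
    "\<And>x. x \<in> vcarrier F \<Longrightarrow> fst (\<sigma> x) = p x"
    by (rule lift[OF K]) (rule that)
  have "splits fg (snd \<circ> \<sigma>)"
    unfolding splits_def
  proof (intro conjI ballI)
    show "Vector_Spaces.linear (vscale F) (*) (snd \<circ> \<sigma>)"
      using \<sigma>(1) vector_space_mult unfolding Vector_Spaces.linear_iff
      by (simp add: cocycle_extension_def prod_scale_def)
    show "(snd \<circ> \<sigma>) (x \<stileturn>\<^bsub>F\<^esub> y) = fst fg (p x) (p y)" "(snd \<circ> \<sigma>) (x \<turnstile>\<^bsub>F\<^esub> y) = snd fg (p x) (p y)"
      if "x \<in> vcarrier F" "y \<in> vcarrier F" for x y
      using that \<sigma>(2,3) fg unfolding dialg_hom_iff[OF F.diassociative_algebra_axioms K]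
      by (simp_all add: cocycle_extension_def)
  qed
  then show thesis
    by (rule that)
qed

end

section \<open>The second cohomology space\<close>

abbreviation pair_scale ::
    "'f::field \<Rightarrow> ('v \<Rightarrow> 'v \<Rightarrow> 'f) \<times> ('v \<Rightarrow> 'v \<Rightarrow> 'f) \<Rightarrow> ('v \<Rightarrow> 'v \<Rightarrow> 'f) \<times> ('v \<Rightarrow> 'v \<Rightarrow> 'f)" where
  "pair_scale \<equiv> \<lambda>c (f, g). (\<lambda>i j. c * f i j, \<lambda>i j. c * g i j)"

lemma vector_space_pair_scale: "vector_space pair_scale"
  by unfold_locales (auto simp: fun_eq_iff algebra_simps)

lemma bilinear_form_on_add:
  assumes "diassociative_algebra L" "bilinear_form_on L f" "bilinear_form_on L g"
  shows "bilinear_form_on L (f + g)"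
  using assms(2,3) unfolding bilinear_form_on_iff[OF assms(1)] by (simp add: algebra_simps)

lemma bilinear_form_on_scale:
  assumes "diassociative_algebra L" "bilinear_form_on L f"
  shows "bilinear_form_on L (\<lambda>i j. c * f i j)"
  using assms(2) unfolding bilinear_form_on_iff[OF assms(1)] by (simp add: algebra_simps)

section \<open>Cocycles and coboundaries as linear forms on \<open>F\<close>\<close>

context linear_free_presentation
begin

lemma splits_linear: "splits x \<tau> \<Longrightarrow> Vector_Spaces.linear (vscale F) (*) \<tau>"
  by (simp add: splits_def)

lemma splits_add:
  assumes "splits x \<tau>" "splits y \<tau>'"
  shows "splits (x + y) (\<lambda>a. \<tau> a + \<tau>' a)"
  using assms unfolding splits_def Vector_Spaces.linear_iff by (simp add: algebra_simps)

lemma splits_scale: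
  assumes "splits x \<tau>"
  shows "splits (pair_scale c x) (\<lambda>a. c * \<tau> a)"
  using assms unfolding splits_def Vector_Spaces.linear_iff by (cases x) (simp add: algebra_simps)

lemma splits_unique:
  assumes "splits x \<tau>" "splits x \<tau>'" "a \<in> derived F"
  shows "\<tau> a = \<tau>' a"
proof -
  interpret vector_space_pair "vscale F" "(*)"
    by (intro vector_space_pair.intro F.vector_space vector_space_mult)
  show ?thesis
    by (rule linear_eq_on[OF assms(1,2)[THEN splits_linear] assms(3)[unfolded F.derived_eq_span]])
      (use assms(1,2) in \<open>auto simp: F.products_def splits_def\<close>)
qed

text \<open>On a product with a factor in \<open>R\<close>, the form \<open>\<tau>\<close> is a
  value of a bilinear form with one argument equal to 0.\<close>

lemma splits_zero_on_W:
  assumes "splits x \<tau>" "bilinear_form_on L (fst x)" "bilinear_form_on L (snd x)" "w \<in> W"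
  shows "\<tau> w = 0"
proof -
  have "h 0 i = 0 \<and> h i 0 = 0" if "bilinear_form_on L h" "i \<in> vcarrier L" for h i
    using that(1)[unfolded bilinear_form_on_iff[OF L.diassociative_algebra_axioms], THEN conjunct2,
        THEN conjunct1, rule_format, of i 0 0] that(2) L.carrier_closed(1) by simp
  then show ?thesis
    using assms(1-3) R_subset
    by (intro linear_zero_on_W[OF splits_linear[OF assms(1)] _ assms(4)])
      (auto simp: splits_def p_R p_simps)
qed

text \<open>Identities in \<open>L\<close> can so be checked on lifts to \<open>F\<close>, where
  \<open>splits\<close> gives the values.\<close>

lemma surj_ball: "(\<forall>i\<in>vcarrier L. P i) \<longleftrightarrow> (\<forall>x\<in>vcarrier F. P (p x))"
  unfolding p_surj[symmetric] by blast

text \<open>Given a splitting \<open>\<tau>\<close>, each cocycle condition is \<open>\<tau>\<close>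
  applied to an axiom of the diassociative algebra \<open>F\<close>, after lifting the three
  arguments.\<close>

lemma cocycles2_iff:
  "x \<in> cocycles2 L \<longleftrightarrow> bilinear_form_on L (fst x) \<and> bilinear_form_on L (snd x) \<and> (\<exists>\<tau>. splits x \<tau>)"
    (is "?Z \<longleftrightarrow> ?S")
proof
  assume ?Z
  moreover from this obtain \<tau> where "splits x \<tau>"
    by (rule cocycle_splits)
  ultimately show ?S
    by (cases x) (auto simp: cocycles2_def)
next
  assume ?S
  then obtain \<tau> where \<tau>: "splits x \<tau>"
    by blast
  have sp: "fst x (p a) (p b) = \<tau> (a \<stileturn>\<^bsub>F\<^esub> b)" "snd x (p a) (p b) = \<tau> (a \<turnstile>\<^bsub>F\<^esub> b)"
    if "a \<in> vcarrier F" "b \<in> vcarrier F" for a b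
    using \<tau> that by (simp_all add: splits_def)
  have "\<forall>i\<in>vcarrier L. \<forall>j\<in>vcarrier L. \<forall>k\<in>vcarrier L.
        fst x i (j \<stileturn>\<^bsub>L\<^esub> k) = fst x i (j \<turnstile>\<^bsub>L\<^esub> k) \<and>
        fst x (i \<turnstile>\<^bsub>L\<^esub> j) k = snd x i (j \<stileturn>\<^bsub>L\<^esub> k) \<and>
        snd x (i \<stileturn>\<^bsub>L\<^esub> j) k = snd x (i \<turnstile>\<^bsub>L\<^esub> j) k \<and>
        fst x i (j \<stileturn>\<^bsub>L\<^esub> k) = fst x (i \<stileturn>\<^bsub>L\<^esub> j) k \<and>
        snd x i (j \<turnstile>\<^bsub>L\<^esub> k) = snd x (i \<turnstile>\<^bsub>L\<^esub> j) k"
    unfolding surj_ball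
  proof (intro ballI)
    fix a b c assume abc: "a \<in> vcarrier F" "b \<in> vcarrier F" "c \<in> vcarrier F"
    note simps = p_simps(2,3)[symmetric] sp abc F.lprod_closed F.rprod_closed
    show "fst x (p a) (p b \<stileturn>\<^bsub>L\<^esub> p c) = fst x (p a) (p b \<turnstile>\<^bsub>L\<^esub> p c) \<and>
        fst x (p a \<turnstile>\<^bsub>L\<^esub> p b) (p c) = snd x (p a) (p b \<stileturn>\<^bsub>L\<^esub> p c) \<and>
        snd x (p a \<stileturn>\<^bsub>L\<^esub> p b) (p c) = snd x (p a \<turnstile>\<^bsub>L\<^esub> p b) (p c) \<and>
        fst x (p a) (p b \<stileturn>\<^bsub>L\<^esub> p c) = fst x (p a \<stileturn>\<^bsub>L\<^esub> p b) (p c) \<and>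
        snd x (p a) (p b \<turnstile>\<^bsub>L\<^esub> p c) = snd x (p a \<turnstile>\<^bsub>L\<^esub> p b) (p c)"
      by (simp only: simps F.lprod_inner F.lprod_assoc F.rprod_assoc F.mixed_assoc F.rprod_inner simp_thms)
  qed
  with \<open>?S\<close> show ?Z
    unfolding cocycles2_def mem_Collect_eq case_prod_unfold by blast
qed

text \<open>A coboundary given by \<open>e\<close> is split by \<open>- e \<circ> p\<close>, up to
  values outside the carrier, and this form kills \<open>R\<close>. Conversely, \<open>N\<close> is
  the kernel of \<open>p\<close> on \<open>F'\<close>, so a splitting form that kills
  \<open>N\<close> factors there through \<open>p\<close>; the factor with its sign changed is
  \<open>e\<close>.\<close>

lemma coboundaries2_iff:
  "x \<in> coboundaries2 L \<longleftrightarrow> bilinear_form_on L (fst x) \<and> bilinear_form_on L (snd x) \<and>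
    (\<exists>\<tau>. splits x \<tau> \<and> (\<forall>n\<in>N. \<tau> n = 0))" (is "?B \<longleftrightarrow> ?S")
proof
  interpret LF: vector_space_pair "vscale L" "(*)"
    by (intro vector_space_pair.intro L.vector_space vector_space_mult)
  assume ?B
  then obtain e where bil: "bilinear_form_on L (fst x)" "bilinear_form_on L (snd x)"
    and e: "linear_form L e" "\<forall>i\<in>vcarrier L. \<forall>j\<in>vcarrier L.
      fst x i j = - e (i \<stileturn>\<^bsub>L\<^esub> j) \<and> snd x i j = - e (i \<turnstile>\<^bsub>L\<^esub> j)"
    unfolding coboundaries2_def by auto
  obtain \<epsilon> where \<epsilon>: "Vector_Spaces.linear (vscale L) (*) \<epsilon>" "\<And>i. i \<in> vcarrier L \<Longrightarrow> \<epsilon> i = e i"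
    by (rule LF.linear_extend_subspace[OF L.subspace, of e])
      (use e(1) linear_form_iff[OF L.diassociative_algebra_axioms] that in auto)
  interpret \<epsilon>: Vector_Spaces.linear "vscale L" "(*)" \<epsilon> by fact
  have "Vector_Spaces.linear (vscale F) (*) (\<lambda>a. - \<epsilon> (p a))"
    unfolding Vector_Spaces.linear_iff
    by (simp add: F.vector_space vector_space_mult p.add p.scale \<epsilon>.add \<epsilon>.scale)
  then have "splits x (\<lambda>a. - \<epsilon> (p a))"
    using e(2) by (simp add: splits_def p_simps \<epsilon>(2) L.lprod_closed L.rprod_closed)
  then show ?S
    using bil by (intro conjI exI[of _ "\<lambda>a. - \<epsilon> (p a)"]) (auto simp: p_R \<epsilon>.zero)
next
  assume ?S
  then obtain \<tau> where \<tau>: "splits x \<tau>" "\<forall>n\<in>N. \<tau> n = 0"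
    by blast
  obtain \<epsilon> where \<epsilon>: "Vector_Spaces.linear (vscale L) (*) \<epsilon>" "\<And>a. a \<in> derived F \<Longrightarrow> \<epsilon> (p a) = \<tau> a"
    by (rule linear_factor[OF p_linear splits_linear[OF \<tau>(1)] F.subspace_derived])
      (use \<tau>(2) F.derived_closed that in \<open>auto simp: R_eq\<close>)
  interpret \<epsilon>: Vector_Spaces.linear "vscale L" "(*)" \<epsilon> by fact
  have "linear_form L (\<lambda>i. - \<epsilon> i)"
    by (simp add: linear_form_iff[OF L.diassociative_algebra_axioms] \<epsilon>.add \<epsilon>.scale)
  moreover have "\<forall>i\<in>vcarrier L. \<forall>j\<in>vcarrier L.
      fst x i j = - (- \<epsilon> (i \<stileturn>\<^bsub>L\<^esub> j)) \<and> snd x i j = - (- \<epsilon> (i \<turnstile>\<^bsub>L\<^esub> j))"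
    unfolding surj_ball
  proof (intro ballI)
    fix a b assume ab: "a \<in> vcarrier F" "b \<in> vcarrier F"
    then have "\<epsilon> (p (a \<stileturn>\<^bsub>F\<^esub> b)) = \<tau> (a \<stileturn>\<^bsub>F\<^esub> b)" "\<epsilon> (p (a \<turnstile>\<^bsub>F\<^esub> b)) = \<tau> (a \<turnstile>\<^bsub>F\<^esub> b)"
      by (simp_all only: \<epsilon>(2) F.products_in_derived)
    with ab \<tau>(1) show "fst x (p a) (p b) = - (- \<epsilon> (p a \<stileturn>\<^bsub>L\<^esub> p b)) \<and>
        snd x (p a) (p b) = - (- \<epsilon> (p a \<turnstile>\<^bsub>L\<^esub> p b))"
      by (simp add: p_simps splits_def)
  qed
  ultimately show ?B
    using \<open>?S\<close> by (cases x) (auto simp: coboundaries2_def)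
qed

text \<open>Define the forms through a section \<open>s\<close> of \<open>p\<close>. Lifts of the
  same element differ by an element of \<open>R\<close>, so their products differ by an element of
  \<open>W\<close>, where \<open>\<tau>\<close> is 0. Any lifts therefore give the same values, and
  bilinearity follows.\<close>

lemma splits_exists:
  assumes \<tau>: "Vector_Spaces.linear (vscale F) (*) \<tau>" and W: "\<And>w. w \<in> W \<Longrightarrow> \<tau> w = 0"
  obtains x where "x \<in> cocycles2 L" "splits x \<tau>"
proof -
  interpret \<tau>: Vector_Spaces.linear "vscale F" "(*)" \<tau> by fact
  define s where "s = inv_into (vcarrier F) p"
  define f where "f i j = (if i \<in> vcarrier L \<and> j \<in> vcarrier L then \<tau> (s i \<stileturn>\<^bsub>F\<^esub> s j) else 0)" for i j
  define g where "g i j = (if i \<in> vcarrier L \<and> j \<in> vcarrier L then \<tau> (s i \<turnstile>\<^bsub>F\<^esub> s j) else 0)" for i j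
  have fg: "f (p a) (p b) = \<tau> (a \<stileturn>\<^bsub>F\<^esub> b)" "g (p a) (p b) = \<tau> (a \<turnstile>\<^bsub>F\<^esub> b)"
    if ab: "a \<in> vcarrier F" "b \<in> vcarrier F" for a b
  proof -
    let ?a = "s (p a)" and ?b = "s (p b)"
    have s: "?a \<in> vcarrier F" "?b \<in> vcarrier F" "p ?a = p a" "p ?b = p b"
      using ab by (simp_all add: s_def inv_into_into f_inv_into_f)
    then have r: "?a - a \<in> R" "?b - b \<in> R"
      using ab by (simp_all add: R_eq F.carrier_closed p.diff)
    have "?a \<stileturn>\<^bsub>F\<^esub> ?b - a \<stileturn>\<^bsub>F\<^esub> b = (?a - a) \<stileturn>\<^bsub>F\<^esub> ?b + a \<stileturn>\<^bsub>F\<^esub> (?b - b)"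
      "?a \<turnstile>\<^bsub>F\<^esub> ?b - a \<turnstile>\<^bsub>F\<^esub> b = (?a - a) \<turnstile>\<^bsub>F\<^esub> ?b + a \<turnstile>\<^bsub>F\<^esub> (?b - b)"
      using s ab by (simp_all add: F.product_diff)
    moreover have "\<tau> ((?a - a) \<stileturn>\<^bsub>F\<^esub> ?b + a \<stileturn>\<^bsub>F\<^esub> (?b - b)) = 0"
      "\<tau> ((?a - a) \<turnstile>\<^bsub>F\<^esub> ?b + a \<turnstile>\<^bsub>F\<^esub> (?b - b)) = 0"
      using products_R_in_W[OF s(2) r(1)] products_R_in_W[OF ab(1) r(2)] by (simp_all add: \<tau>.add W)
    ultimately have "\<tau> (?a \<stileturn>\<^bsub>F\<^esub> ?b) - \<tau> (a \<stileturn>\<^bsub>F\<^esub> b) = 0" "\<tau> (?a \<turnstile>\<^bsub>F\<^esub> ?b) - \<tau> (a \<turnstile>\<^bsub>F\<^esub> b) = 0"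
      by (metis \<tau>.diff)+
    then show "f (p a) (p b) = \<tau> (a \<stileturn>\<^bsub>F\<^esub> b)" "g (p a) (p b) = \<tau> (a \<turnstile>\<^bsub>F\<^esub> b)"
      using ab by (simp_all add: f_def g_def p_simps)
  qed
  have "bilinear_form_on L f" "bilinear_form_on L g"
    unfolding bilinear_form_on_iff[OF L.diassociative_algebra_axioms] surj_ball
    by (simp_all add: fg F.carrier_closed F.product_simps \<tau>.add \<tau>.scale flip: p.add p.scale)
      (simp_all add: f_def g_def)
  moreover have "splits (f, g) \<tau>"
    by (simp add: splits_def \<tau> fg)
  ultimately show thesis
    by (intro that[of "(f, g)"]) (auto simp: cocycles2_iff)
qed

text \<open>Splitting forms can be added and scaled together with the pairs that they split, and
  vanishing on \<open>N\<close> is preserved.\<close>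

lemma subspace_cocycles2: "module.subspace pair_scale (cocycles2 L)"
  and subspace_coboundaries2: "module.subspace pair_scale (coboundaries2 L)"
proof -
  interpret P: vector_space "pair_scale :: 'f \<Rightarrow> ('l \<Rightarrow> 'l \<Rightarrow> 'f) \<times> ('l \<Rightarrow> 'l \<Rightarrow> 'f) \<Rightarrow> _"
    by (rule vector_space_pair_scale)
  let ?bil = "\<lambda>x. bilinear_form_on L (fst x) \<and> bilinear_form_on L (snd x)"
  have bil_0: "?bil 0"
    unfolding bilinear_form_on_iff[OF L.diassociative_algebra_axioms] by simp
  have bil_add: "?bil (x + y)" if "?bil x" "?bil y" for x y
    using that by (simp add: bilinear_form_on_add L.diassociative_algebra_axioms)
  have bil_scale: "?bil (pair_scale c x)" if "?bil x" for c x
    using that by (simp add: case_prod_unfold bilinear_form_on_scale L.diassociative_algebra_axioms)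
  have splits_0: "splits 0 (\<lambda>_. 0)"
    unfolding splits_def Vector_Spaces.linear_iff by (auto simp: F.vector_space vector_space_mult)
  have Z: "x \<in> cocycles2 L \<longleftrightarrow> ?bil x \<and> (\<exists>\<tau>. splits x \<tau>)" for x
    unfolding cocycles2_iff by (simp only: conj_assoc)
  have B: "x \<in> coboundaries2 L \<longleftrightarrow> ?bil x \<and> (\<exists>\<tau>. splits x \<tau> \<and> (\<forall>n\<in>N. \<tau> n = 0))" for x
    unfolding coboundaries2_iff by (simp only: conj_assoc)
  show "P.subspace (cocycles2 L)"
  proof (rule P.subspaceI)
    show "0 \<in> cocycles2 L"
      unfolding Z by (rule conjI[OF bil_0 exI[of _ "\<lambda>_. 0"]], rule splits_0)
    show "x + y \<in> cocycles2 L" if xy: "x \<in> cocycles2 L" "y \<in> cocycles2 L" for x y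
    proof -
      obtain \<tau> \<tau>' where h: "?bil x" "?bil y" "splits x \<tau>" "splits y \<tau>'"
        using xy unfolding Z by blast
      show ?thesis
        unfolding Z by (rule conjI[OF bil_add[OF h(1,2)]], rule exI, rule splits_add[OF h(3,4)])
    qed
    show "pair_scale c x \<in> cocycles2 L" if x: "x \<in> cocycles2 L" for c x
    proof -
      obtain \<tau> where h: "?bil x" "splits x \<tau>"
        using x unfolding Z by blast
      show ?thesis
        unfolding Z by (rule conjI[OF bil_scale[OF h(1)]], rule exI, rule splits_scale[OF h(2)])
    qed
  qed
  show "P.subspace (coboundaries2 L)"
  proof (rule P.subspaceI)
    show "0 \<in> coboundaries2 L"
      unfolding B by (rule conjI[OF bil_0 exI[of _ "\<lambda>_. 0"]], rule conjI[OF splits_0]) simp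
    show "x + y \<in> coboundaries2 L" if xy: "x \<in> coboundaries2 L" "y \<in> coboundaries2 L" for x y
    proof -
      obtain \<tau> \<tau>' where h: "?bil x" "?bil y" "splits x \<tau>" "splits y \<tau>'"
        and zero: "\<forall>n\<in>N. \<tau> n = 0" "\<forall>n\<in>N. \<tau>' n = 0"
        using xy unfolding B by blast
      show ?thesis
        unfolding B
        by (rule conjI[OF bil_add[OF h(1,2)]], rule exI, rule conjI[OF splits_add[OF h(3,4)]])
          (simp add: zero)
    qed
    show "pair_scale c x \<in> coboundaries2 L" if x: "x \<in> coboundaries2 L" for c x
    proof -
      obtain \<tau> where h: "?bil x" "splits x \<tau>" and zero: "\<forall>n\<in>N. \<tau> n = 0"
        using x unfolding B by blast
      show ?thesis
        unfolding B
        by (rule conjI[OF bil_scale[OF h(1)]], rule exI, rule conjI[OF splits_scale[OF h(2)]])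
          (simp add: zero)
    qed
  qed
qed

section \<open>Restriction of splitting forms to \<open>N / W\<close>\<close>

lemma hopf_quotient_simps:
  "vcarrier (hopf_quotient F R) = coset W ` N"
  "vplus (hopf_quotient F R) (coset W a) (coset W b) = coset W (a + b)"
  "vscale (hopf_quotient F R) c (coset W a) = coset W (vscale F c a)"
  by (simp_all add: hopf_quotient_def F.vs.quotient_space_simps[OF subspace_W])

text \<open>The restriction to \<open>N\<close> of a form that splits \<open>x\<close>, regarded as
  a function of cosets. The value 0 elsewhere is the convention of \<open>dual_space\<close>;
  \<open>transgression_coset\<close> shows that neither choice matters for a cocycle.\<close>

definition transgression :: "('l \<Rightarrow> 'l \<Rightarrow> 'f) \<times> ('l \<Rightarrow> 'l \<Rightarrow> 'f) \<Rightarrow> 'a set \<Rightarrow> 'f" where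
  "transgression x A = (if A \<in> coset W ` N
     then (SOME \<tau>. splits x \<tau>) (SOME n. n \<in> N \<and> A = coset W n) else 0)"

text \<open>Two splitting forms of \<open>x\<close> agree on \<open>F'\<close>, which contains
  \<open>N\<close>, and a splitting form is constant on cosets of \<open>W\<close>.\<close>

lemma transgression_coset:
  assumes x: "x \<in> cocycles2 L" and \<tau>: "splits x \<tau>" and n: "n \<in> N"
  shows "transgression x (coset W n) = \<tau> n"
proof -
  let ?t = "SOME \<tau>. splits x \<tau>" and ?n = "SOME m. m \<in> N \<and> coset W n = coset W m"
  have t: "splits x ?t"
    using \<tau> by (rule someI[of "splits x"])
  have "n \<in> N \<and> coset W n = coset W n"
    using n by simp
  then have m: "?n \<in> N \<and> coset W n = coset W ?n"
    by (rule someI[of "\<lambda>m. m \<in> N \<and> coset W n = coset W m"])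
  then have "n - ?n \<in> W"
    using F.vs.coset_eq_iff[OF subspace_W] by blast
  then have "\<tau> (n - ?n) = 0"
    using x \<tau> by (intro splits_zero_on_W[of x]) (auto simp: cocycles2_iff)
  moreover have "?t ?n = \<tau> ?n"
    using m by (intro splits_unique[OF t \<tau>]) simp
  moreover have "\<tau> (n - ?n) = \<tau> n - \<tau> ?n"
    using splits_linear[OF \<tau>] by (rule module_hom.diff[OF linear_iff_module_hom[THEN iffD1]])
  ultimately show ?thesis
    using n by (simp add: transgression_def)
qed

text \<open>\<open>transgression\<close> is linear on cocycles, maps onto the dual and identifies
  two cocycles exactly if their difference is a coboundary; the first isomorphism theorem
  concludes.\<close>

theorem H2_iso_dual: "vs_iso (H2 L) (dual_space (hopf_quotient F R))"
proof -
  interpret P: vector_space "pair_scale :: 'f \<Rightarrow> ('l \<Rightarrow> 'l \<Rightarrow> 'f) \<times> ('l \<Rightarrow> 'l \<Rightarrow> 'f) \<Rightarrow> _"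
    by (rule vector_space_pair_scale)
  interpret FF: vector_space_pair "vscale F" "(*)"
    by (intro vector_space_pair.intro F.vector_space vector_space_mult)
  let ?Q = "hopf_quotient F R"
  have outside: "transgression x A = 0" if "A \<notin> coset W ` N" for x A
    using that by (simp add: transgression_def)
  have N: "0 \<in> N" "a + b \<in> N" "vscale F c a \<in> N" if "a \<in> N" "b \<in> N" for a b c
    using subspace_N that unfolding F.vs.subspace_def by blast+
  have dual: "vcarrier (dual_space ?Q) = {e. linear_form ?Q e \<and> (\<forall>A. A \<notin> coset W ` N \<longrightarrow> e A = 0)}"
    by (simp add: dual_space_def subvspace_def hopf_quotient_simps)
  have form: "linear_form ?Q e \<longleftrightarrow>
      (\<forall>a\<in>N. \<forall>b\<in>N. e (coset W (a + b)) = e (coset W a) + e (coset W b)) \<and>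
      (\<forall>c. \<forall>a\<in>N. e (coset W (vscale F c a)) = c * e (coset W a))" for e
    by (simp add: linear_form_def hopf_quotient_simps)
  have eqI: "e = e'" if "\<And>A. A \<notin> coset W ` N \<Longrightarrow> e A = e' A" "\<And>n. n \<in> N \<Longrightarrow> e (coset W n) = e' (coset W n)"
    for e e' :: "'a set \<Rightarrow> 'f"
  proof
    show "e A = e' A" for A
      using that by (cases "A \<in> coset W ` N") blast+
  qed
  have t_add: "transgression (x + y) = transgression x + transgression y"
    if xy: "x \<in> cocycles2 L" "y \<in> cocycles2 L" for x y
  proof (rule eqI)
    obtain \<tau> \<tau>' where \<tau>: "splits x \<tau>" "splits y \<tau>'"
      using xy unfolding cocycles2_iff by blast
    show "transgression (x + y) (coset W n) = (transgression x + transgression y) (coset W n)"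
      if "n \<in> N" for n
      using transgression_coset[OF P.subspace_add[OF subspace_cocycles2 xy] splits_add[OF \<tau>] that]
        transgression_coset[OF xy(1) \<tau>(1) that] transgression_coset[OF xy(2) \<tau>(2) that] by simp
  qed (simp add: outside)
  have t_scale: "transgression (pair_scale c x) = (\<lambda>A. c * transgression x A)"
    if x: "x \<in> cocycles2 L" for c x
  proof (rule eqI)
    obtain \<tau> where \<tau>: "splits x \<tau>"
      using x unfolding cocycles2_iff by blast
    show "transgression (pair_scale c x) (coset W n) = c * transgression x (coset W n)"
      if "n \<in> N" for n
      using transgression_coset[OF P.subspace_scale[OF subspace_cocycles2 x] splits_scale[OF \<tau>] that]
        transgression_coset[OF x \<tau> that] by simp
  qed (simp add: outside)
  have "transgression ` cocycles2 L = vcarrier (dual_space ?Q)"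
  proof (intro equalityI subsetI)
    fix e assume "e \<in> transgression ` cocycles2 L"
    then obtain x where x: "x \<in> cocycles2 L" "e = transgression x"
      by blast
    then obtain \<tau> where \<tau>: "splits x \<tau>"
      unfolding cocycles2_iff by blast
    interpret \<tau>: Vector_Spaces.linear "vscale F" "(*)" \<tau>
      by (rule splits_linear[OF \<tau>])
    have "e (coset W n) = \<tau> n" if "n \<in> N" for n
      using transgression_coset[OF x(1) \<tau> that] x(2) by simp
    then show "e \<in> vcarrier (dual_space ?Q)"
      unfolding dual mem_Collect_eq form using outside x(2) by (simp add: N[simplified] \<tau>.add \<tau>.scale)
  next
    fix e assume e: "e \<in> vcarrier (dual_space ?Q)"
    \<comment> \<open>A form on \<open>N / W\<close>, read on \<open>N\<close> and extended to all
      of \<open>F\<close>, still kills \<open>W\<close>, so it splits some cocycle.\<close>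
    obtain \<tau> where \<tau>: "Vector_Spaces.linear (vscale F) (*) \<tau>" "\<And>n. n \<in> N \<Longrightarrow> \<tau> n = e (coset W n)"
      by (rule FF.linear_extend_subspace[OF subspace_N, of "\<lambda>n. e (coset W n)"])
        (use e that in \<open>auto simp: dual form\<close>)
    interpret \<tau>: Vector_Spaces.linear "vscale F" "(*)" \<tau> by fact
    have "\<tau> w = 0" if "w \<in> W" for w
    proof -
      have "coset W w = coset W 0"
        using that by (simp add: F.vs.coset_eq_iff[OF subspace_W])
      then show ?thesis
        using \<tau>(2)[of w] \<tau>(2)[of 0] that W_subset_N F.vs.subspace_0[OF subspace_N] by auto
    qed
    then obtain x where x: "x \<in> cocycles2 L" "splits x \<tau>"
      using splits_exists[OF \<tau>(1)] by blast
    have "e = transgression x"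
      using e transgression_coset[OF x] \<tau>(2) outside by (intro eqI) (auto simp: dual)
    with x(1) show "e \<in> transgression ` cocycles2 L"
      by blast
  qed
  moreover have "transgression x = transgression y \<longleftrightarrow> x - y \<in> coboundaries2 L"
    if xy: "x \<in> cocycles2 L" "y \<in> cocycles2 L" for x y
  proof -
    \<comment> \<open>Additivity reduces the comparison of \<open>x\<close> and \<open>y\<close> to
      the vanishing of the image of their difference.\<close>
    have d: "x - y \<in> cocycles2 L"
      by (rule P.subspace_diff[OF subspace_cocycles2 xy])
    have "transgression x = transgression (x - y) + transgression y"
      using t_add[OF d xy(2)] by simp
    then have "transgression x = transgression y \<longleftrightarrow> transgression (x - y) = 0"
      by simp
    also have "\<dots> \<longleftrightarrow> x - y \<in> coboundaries2 L"
    proof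
      obtain \<tau> where \<tau>: "splits (x - y) \<tau>"
        using d unfolding cocycles2_iff by blast
      assume "transgression (x - y) = 0"
      then have "\<forall>n\<in>N. \<tau> n = 0"
        using transgression_coset[OF d \<tau>] by simp
      then show "x - y \<in> coboundaries2 L"
        using \<tau> d unfolding coboundaries2_iff cocycles2_iff by blast
    next
      assume "x - y \<in> coboundaries2 L"
      then obtain \<tau> where "splits (x - y) \<tau>" "\<forall>n\<in>N. \<tau> n = 0"
        unfolding coboundaries2_iff by blast
      then show "transgression (x - y) = 0"
        using transgression_coset[OF d] outside by (intro eqI) auto
    qed
    finally show ?thesis .
  qed
  ultimately show ?thesis
    unfolding H2_def
  proof (intro P.quotient_space_iso subspace_cocycles2 subspace_coboundaries2)
    show "transgression (x + y) = vplus (dual_space ?Q) (transgression x) (transgression y)"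
      if "x \<in> cocycles2 L" "y \<in> cocycles2 L" for x y
      using t_add[OF that] by (simp add: dual_space_def subvspace_def)
    show "transgression (pair_scale c x) = vscale (dual_space ?Q) c (transgression x)"
      if "x \<in> cocycles2 L" for c x
      using t_scale[OF that] by (simp add: dual_space_def subvspace_def)
  qed
qed

end

section \<open>Defining pairs and multipliers\<close>

text \<open>The image of a finite basis of \<open>C\<close> spans \<open>M\<close>. A finite
  spanning set is recorded together with the bound, because \<open>dim\<close> alone does not show
  finite dimension.\<close>

lemma (in vector_space_pair) dim_image_le:
  assumes f: "Vector_Spaces.linear s1 s2 f" and C: "finite T" "C \<subseteq> vs1.span T" and M: "M \<subseteq> f ` C"
  shows "vs2.dim M \<le> vs1.dim C" "\<exists>T'. finite T' \<and> M \<subseteq> vs2.span T'"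
proof -
  interpret f: Vector_Spaces.linear s1 s2 f by fact
  obtain B where B: "B \<subseteq> C" "vs1.independent B" "C \<subseteq> vs1.span B" "card B = vs1.dim C"
    using vs1.basis_exists by blast
  have fin: "finite B"
    using vs1.independent_span_bound[OF C(1) B(2)] B(1) C(2) by blast
  have "M \<subseteq> vs2.span (f ` B)"
    using M B(3) by (auto simp: f.span_image)
  then show "vs2.dim M \<le> vs1.dim C" "\<exists>T'. finite T' \<and> M \<subseteq> vs2.span T'"
    using vs2.dim_le_card[of M "f ` B"] card_image_le[OF fin, of f] fin B(4) by auto
qed

section \<open>Products of spans, and quotients by central subspaces\<close>

context diassociative_algebra
begin

text \<open>Bilinearity, one argument at a time: first \<open>y\<close> runs through the span with
  the left factor in \<open>X\<close>, then \<open>x\<close> does.\<close>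

lemma products_span:
  assumes "X \<subseteq> vcarrier A" "Y \<subseteq> vcarrier A" "x \<in> vs.span X" "y \<in> vs.span Y"
  shows "x \<stileturn> y \<in> vs.span (products X Y)" "x \<turnstile> y \<in> vs.span (products X Y)"
proof -
  have sub: "vs.span X \<subseteq> vcarrier A" "vs.span Y \<subseteq> vcarrier A"
    using assms(1,2) subspace by (simp_all add: vs.span_minimal)
  let ?S = "vs.span (products X Y)"
  have step: "u \<stileturn> y \<in> ?S \<and> u \<turnstile> y \<in> ?S" if "u \<in> X" for u
  proof -
    have "vs.subspace {v \<in> vcarrier A. u \<stileturn> v \<in> ?S \<and> u \<turnstile> v \<in> ?S}"
      using that assms(1)
      by (auto simp: vs.subspace_def carrier_closed product_zero product_simps vs.span_zero
          vs.span_add vs.span_scale)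
    then have "vs.span Y \<subseteq> {v \<in> vcarrier A. u \<stileturn> v \<in> ?S \<and> u \<turnstile> v \<in> ?S}"
      using that assms(2) by (intro vs.span_minimal) (auto intro!: vs.span_base productsI)
    with assms(4) show ?thesis
      by blast
  qed
  have "vs.subspace {u \<in> vcarrier A. u \<stileturn> y \<in> ?S \<and> u \<turnstile> y \<in> ?S}"
    using assms(4) sub(2)
    by (auto simp: vs.subspace_def carrier_closed product_zero product_simps vs.span_zero
        vs.span_add vs.span_scale subset_iff)
  then have "vs.span X \<subseteq> {u \<in> vcarrier A. u \<stileturn> y \<in> ?S \<and> u \<turnstile> y \<in> ?S}"
    using step assms(1) by (intro vs.span_minimal) auto
  with assms(3) show "x \<stileturn> y \<in> ?S" "x \<turnstile> y \<in> ?S"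
    by blast+
qed

text \<open>As \<open>M\<close> is central, changing the representatives by elements of
  \<open>M\<close> does not change the products at all.\<close>

lemma quotient_algebra_products:
  assumes M: "vs.subspace M" "M \<subseteq> center A" and ab: "a \<in> vcarrier A" "b \<in> vcarrier A"
  shows "coset M a \<stileturn>\<^bsub>quotient_algebra A M\<^esub> coset M b = coset M (a \<stileturn> b)"
    "coset M a \<turnstile>\<^bsub>quotient_algebra A M\<^esub> coset M b = coset M (a \<turnstile> b)"
proof -
  have *: "(a + m) \<stileturn> (b + n) = a \<stileturn> b" "(a + m) \<turnstile> (b + n) = a \<turnstile> b"
    if "m \<in> M" "n \<in> M" for m n
    using that M(2) ab by (auto simp: center_def subset_iff product_simps carrier_closed)
  have "0 \<in> M"
    using M(1) by (rule vs.subspace_0)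
  then have "{x \<stileturn> y + m |x y m. x \<in> coset M a \<and> y \<in> coset M b \<and> m \<in> M} = coset M (a \<stileturn> b)"
    "{x \<turnstile> y + m |x y m. x \<in> coset M a \<and> y \<in> coset M b \<and> m \<in> M} = coset M (a \<turnstile> b)"
    unfolding coset_def using * by (safe; fastforce)+
  then show "coset M a \<stileturn>\<^bsub>quotient_algebra A M\<^esub> coset M b = coset M (a \<stileturn> b)"
    "coset M a \<turnstile>\<^bsub>quotient_algebra A M\<^esub> coset M b = coset M (a \<turnstile> b)"
    by (simp_all add: quotient_algebra_def)
qed

lemma quotient_algebra_simps:
  assumes M: "vs.subspace M"
  shows "vcarrier (quotient_algebra A M) = coset M ` vcarrier A"
    "vplus (quotient_algebra A M) (coset M a) (coset M b) = coset M (a + b)"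
    "vscale (quotient_algebra A M) c (coset M a) = coset M (vscale A c a)"
  using vs.quotient_space_simps[OF M] by (simp_all add: quotient_algebra_def)

end

text \<open>A defining pair in the form in which lifting applies: a surjection from \<open>K\<close>
  onto \<open>L\<close>, linear on the whole type, with kernel \<open>M\<close>.\<close>

lemma defining_pairD:
  assumes L: "diassociative_algebra L" and pair: "defining_pair L K M"
  obtains q where "Vector_Spaces.linear (vscale K) (vscale L) q" "q \<in> dialg_hom K L"
    "q ` vcarrier K = vcarrier L" "M = {k \<in> vcarrier K. q k = 0}"
proof -
  interpret L: diassociative_algebra L by fact
  interpret K: diassociative_algebra K
    using pair by (simp add: defining_pair_def)
  have M: "K.vs.subspace M" "M \<subseteq> center K" "M \<subseteq> vcarrier K"
    using pair by (auto simp: defining_pair_def center_def)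
  note Q = K.quotient_algebra_simps[OF M(1)] K.quotient_algebra_products[OF M(1,2)]
  obtain h where h: "h \<in> dialg_hom L (quotient_algebra K M)"
    "bij_betw h (vcarrier L) (coset M ` vcarrier K)"
    using pair unfolding defining_pair_def dialg_iso_def Q by blast
  \<comment> \<open>The projection of \<open>K\<close> onto \<open>K / M\<close> followed by the
    inverse of the isomorphism \<open>h\<close>.\<close>
  define q0 where "q0 k = inv_into (vcarrier L) h (coset M k)" for k
  have q0: "q0 k \<in> vcarrier L" "h (q0 k) = coset M k" if "k \<in> vcarrier K" for k
    using that h(2) by (auto simp: q0_def bij_betw_def inv_into_into f_inv_into_f)
  have inj: "x = y" if "h x = h y" "x \<in> vcarrier L" "y \<in> vcarrier L" for x y
    using that h(2) by (auto simp: bij_betw_def inj_on_def)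
  have h_scale: "h (vscale L c x) = vscale (quotient_algebra K M) c (h x)"
    if "x \<in> vcarrier L" for c x
    using h(1) that by (simp add: dialg_hom_def)
  have hom: "h (x + y) = vplus (quotient_algebra K M) (h x) (h y)"
    "h (x \<stileturn>\<^bsub>L\<^esub> y) = h x \<stileturn>\<^bsub>quotient_algebra K M\<^esub> h y"
    "h (x \<turnstile>\<^bsub>L\<^esub> y) = h x \<turnstile>\<^bsub>quotient_algebra K M\<^esub> h y"
    if "x \<in> vcarrier L" "y \<in> vcarrier L" for x y
    using h(1) that L.vplus_eq by (simp_all add: dialg_hom_def)
  have "q0 \<in> dialg_hom K L"
    unfolding dialg_hom_iff[OF K.diassociative_algebra_axioms L.diassociative_algebra_axioms]
    by (intro conjI ballI allI; (intro inj)?)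
      (simp_all add: q0 hom h_scale Q K.carrier_closed L.carrier_closed K.lprod_closed K.rprod_closed
        L.lprod_closed L.rprod_closed)
  then obtain q where q: "Vector_Spaces.linear (vscale K) (vscale L) q"
    "\<And>k. k \<in> vcarrier K \<Longrightarrow> q k = q0 k" "q \<in> dialg_hom K L"
    by (rule K.hom_linear_extension[OF L.diassociative_algebra_axioms]) (rule that)
  interpret q: Vector_Spaces.linear "vscale K" "vscale L" q by fact
  have h0: "h 0 = coset M 0"
    using q0(2)[of 0] q(2)[of 0] K.carrier_closed(1) by (simp add: q.zero)
  show thesis
  proof (rule that[OF q(1,3)])
    show "q ` vcarrier K = vcarrier L"
    proof (intro equalityI subsetI)
      show "l \<in> vcarrier L" if "l \<in> q ` vcarrier K" for l
        using that q(2) q0(1) by auto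
    next
      fix l assume l: "l \<in> vcarrier L"
      then have "h l \<in> coset M ` vcarrier K"
        using bij_betw_imp_surj_on[OF h(2)] by blast
      then obtain k where k: "k \<in> vcarrier K" "h l = coset M k"
        by blast
      then have "l = q k"
        using l by (intro inj) (simp_all add: q(2) q0)
      with k(1) show "l \<in> q ` vcarrier K"
        by blast
    qed
    have "q k = 0 \<longleftrightarrow> k \<in> M" if k: "k \<in> vcarrier K" for k
    proof -
      have "q k = 0 \<longleftrightarrow> h (q k) = h 0"
        using inj[of "q k" 0] k q0(1) L.carrier_closed(1) by (auto simp: q(2))
      also have "\<dots> \<longleftrightarrow> k \<in> M"
        using k by (simp add: h0 q(2) q0 K.vs.coset_eq_iff[OF M(1)])
      finally show ?thesis .
    qed
    with M(3) show "M = {k \<in> vcarrier K. q k = 0}"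
      by blast
  qed
qed

text \<open>The isomorphism from \<open>L\<close> to \<open>K / M\<close> sends an element to the
  coset of any of its preimages under \<open>q\<close>.\<close>

lemma defining_pairI:
  assumes K: "diassociative_algebra K" and L: "diassociative_algebra L"
    and q: "q \<in> dialg_hom K L" "q ` vcarrier K = vcarrier L" "M = {k \<in> vcarrier K. q k = 0}"
    and M: "M \<subseteq> center K" "M \<subseteq> derived K"
  shows "defining_pair L K M"
proof -
  interpret K: diassociative_algebra K by fact
  interpret L: diassociative_algebra L by fact
  obtain q' where q': "Vector_Spaces.linear (vscale K) (vscale L) q'"
    "\<And>k. k \<in> vcarrier K \<Longrightarrow> q' k = q k" "q' \<in> dialg_hom K L"
    by (rule K.hom_linear_extension[OF L q(1)]) (rule that)
  interpret q': Vector_Spaces.linear "vscale K" "vscale L" q' by fact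
  have Meq: "M = {k \<in> vcarrier K. q' k = 0}"
    using q(3) q'(2) by auto
  have subM: "K.vs.subspace M"
    unfolding Meq K.vs.subspace_def by (auto simp: K.carrier_closed q'.add q'.scale)
  note Q = K.quotient_algebra_simps[OF subM] K.quotient_algebra_products[OF subM M(1)]
  have coset_eq: "coset M a = coset M b \<longleftrightarrow> q a = q b" if "a \<in> vcarrier K" "b \<in> vcarrier K" for a b
    using that unfolding K.vs.coset_eq_iff[OF subM]
    by (simp add: Meq K.carrier_closed q'.diff q'(2))
  define h where "h l = coset M (inv_into (vcarrier K) q l)" for l
  have h: "h (q k) = coset M k" if "k \<in> vcarrier K" for k
  proof -
    have "inv_into (vcarrier K) q (q k) \<in> vcarrier K" "q (inv_into (vcarrier K) q (q k)) = q k"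
      using that by (simp_all add: inv_into_into f_inv_into_f)
    with that show ?thesis
      by (simp add: h_def coset_eq)
  qed
  have hom: "q (vscale K c x) = vscale L c (q x)" "q (x + y) = q x + q y"
    "q (x \<stileturn>\<^bsub>K\<^esub> y) = q x \<stileturn>\<^bsub>L\<^esub> q y" "q (x \<turnstile>\<^bsub>K\<^esub> y) = q x \<turnstile>\<^bsub>L\<^esub> q y"
    if "x \<in> vcarrier K" "y \<in> vcarrier K" for c x y
    using q(1) that by (simp_all add: dialg_hom_iff[OF K L])
  have "h \<in> dialg_hom L (quotient_algebra K M)"
    unfolding dialg_hom_def mem_Collect_eq L.vplus_eq q(2)[symmetric] ball_simps
  proof (intro conjI allI ballI)
    show "h ` q ` vcarrier K \<subseteq> vcarrier (quotient_algebra K M)"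
      by (auto simp: h Q)
  next
    fix c x assume "x \<in> vcarrier K"
    then show "h (vscale L c (q x)) = vscale (quotient_algebra K M) c (h (q x))"
      by (simp add: h Q K.carrier_closed flip: hom(1)[of x x])
  next
    fix x y assume xy: "x \<in> vcarrier K" "y \<in> vcarrier K"
    then show "h (q x + q y) = vplus (quotient_algebra K M) (h (q x)) (h (q y))"
      by (simp add: h Q K.carrier_closed flip: hom)
    from xy show "h (q x \<stileturn>\<^bsub>L\<^esub> q y) = h (q x) \<stileturn>\<^bsub>quotient_algebra K M\<^esub> h (q y)"
      by (simp add: h Q K.lprod_closed flip: hom)
    from xy show "h (q x \<turnstile>\<^bsub>L\<^esub> q y) = h (q x) \<turnstile>\<^bsub>quotient_algebra K M\<^esub> h (q y)"
      by (simp add: h Q K.rprod_closed flip: hom)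
  qed
  moreover have "bij_betw h (vcarrier L) (vcarrier (quotient_algebra K M))"
    unfolding bij_betw_def q(2)[symmetric] Q by (auto simp: inj_on_def h coset_eq image_image)
  ultimately show ?thesis
    using K subM M unfolding defining_pair_def dialg_iso_def by blast
qed

context linear_free_presentation
begin

lemma vs_closed_hopf_quotient: "vs_closed (hopf_quotient F R)"
  unfolding hopf_quotient_def by (rule F.vs.vs_closed_quotient_space[OF subspace_N subspace_W])

lemma vs_closed_H2: "vs_closed (H2 L)"
proof -
  interpret P: vector_space "pair_scale :: 'f \<Rightarrow> ('l \<Rightarrow> 'l \<Rightarrow> 'f) \<times> ('l \<Rightarrow> 'l \<Rightarrow> 'f) \<Rightarrow> _"
    by (rule vector_space_pair_scale)
  show ?thesis
    unfolding H2_def by (rule P.vs_closed_quotient_space[OF subspace_cocycles2 subspace_coboundaries2])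
qed

section \<open>The range of \<open>g\<close> as a model of \<open>N / W\<close>\<close>

context
  fixes g :: "'a \<Rightarrow> 'a"
  assumes g: "Vector_Spaces.linear (vscale F) (vscale F) g"
    and g_range: "g ` N = range g" and g_kernel: "{n \<in> N. g n = 0} = W"
begin

interpretation g: Vector_Spaces.linear "vscale F" "vscale F" g
  by (rule g)

lemma g_W: "w \<in> W \<Longrightarrow> g w = 0"
  using g_kernel by blast

lemma subspace_range_g: "F.vs.subspace (range g)"
  by (rule g.subspace_image[OF F.vs.subspace_UNIV])

lemma hopf_quotient_iso: "vs_iso (hopf_quotient F R) (subvspace (vscale F) (range g))"
  unfolding hopf_quotient_def
proof (rule F.vs.quotient_space_iso[OF subspace_N subspace_W])
  show "g ` N = vcarrier (subvspace (vscale F) (range g))"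
    by (simp add: subvspace_def g_range)
  show "g a = g b \<longleftrightarrow> a - b \<in> W" if "a \<in> N" "b \<in> N" for a b
  proof -
    have "g a = g b \<longleftrightarrow> g (a - b) = 0"
      by (simp add: g.diff)
    then show ?thesis
      using F.vs.subspace_diff[OF subspace_N that] g_kernel by blast
  qed
qed (simp_all add: subvspace_def g.add g.scale)

lemma H2_iso_range:
  assumes "finite T" "range g \<subseteq> F.vs.span T"
  shows "vs_iso (H2 L) (subvspace (vscale F) (range g))"
  using vs_iso_trans[OF H2_iso_dual F.vs.dual_space_iso[OF subspace_range_g hopf_quotient_iso
        vs_closed_hopf_quotient assms]] .

text \<open>\<open>vs_findim\<close> asks for generators inside the carrier. If \<open>T\<close>
  spans from outside, a basis of \<open>range g\<close> is finite and provides them.\<close>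

lemma hopf_quotient_findim_iff:
  "vs_findim (hopf_quotient F R) \<longleftrightarrow> (\<exists>T. finite T \<and> range g \<subseteq> F.vs.span T)"
proof -
  let ?C = "subvspace (vscale F) (range g)"
  have closed: "vs_closed ?C"
    by (rule F.vs.vs_closed_subvspace[OF subspace_range_g])
  have "vs_findim (hopf_quotient F R) \<longleftrightarrow> vs_findim ?C"
    using vs_findim_iso[OF hopf_quotient_iso vs_closed_hopf_quotient]
      vs_findim_iso[OF vs_iso_sym[OF hopf_quotient_iso vs_closed_hopf_quotient] closed] by blast
  also have "\<dots> \<longleftrightarrow> (\<exists>B. finite B \<and> B \<subseteq> range g \<and> range g = F.vs.span B)"
    using vs_findim_iff_finite_span[of ?C] F.vector_space subspace_range_g
    by (simp add: subvspace_def)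
  also have "\<dots> \<longleftrightarrow> (\<exists>T. finite T \<and> range g \<subseteq> F.vs.span T)"
  proof
    assume "\<exists>T. finite T \<and> range g \<subseteq> F.vs.span T"
    then obtain T where T: "finite T" "range g \<subseteq> F.vs.span T"
      by blast
    obtain B where B: "B \<subseteq> range g" "F.vs.independent B" "range g \<subseteq> F.vs.span B"
      using F.vs.maximal_independent_subset by blast
    have "finite B"
      using F.vs.independent_span_bound[OF T(1) B(2)] B(1) T(2) by blast
    moreover have "range g = F.vs.span B"
      using B(1,3) F.vs.span_minimal[OF B(1) subspace_range_g] by blast
    ultimately show "\<exists>B. finite B \<and> B \<subseteq> range g \<and> range g = F.vs.span B"
      using B(1) by blast
  qed blast
  finally show ?thesis .
qed

lemma H2_iso_hopf_quotient:
  assumes "vs_findim (hopf_quotient F R)"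
  shows "vs_iso (H2 L) (hopf_quotient F R)"
proof -
  obtain T where "finite T" "range g \<subseteq> F.vs.span T"
    using assms hopf_quotient_findim_iff by blast
  then show ?thesis
    using vs_iso_trans[OF H2_iso_range vs_iso_sym[OF hopf_quotient_iso vs_closed_hopf_quotient]] by blast
qed

section \<open>Finite dimension and the bound for defining pairs\<close>

context
  fixes B :: "'l set"
  assumes B: "finite B" "vcarrier L = L.vs.span B"
begin

lemma B_closed: "B \<subseteq> vcarrier L"
  using B(2) L.vs.span_superset by simp

text \<open>Preimages of the finite spanning set \<open>B\<close> of \<open>L\<close> span
  \<open>K\<close> up to the kernel of \<open>q\<close>. This is used for \<open>F\<close> over
  \<open>L\<close> as well as for defining pairs.\<close>

lemma finite_lift:
  assumes K: "diassociative_algebra K" and q: "Vector_Spaces.linear (vscale K) (vscale L) q"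
    "q ` vcarrier K = vcarrier L"
  obtains S where "finite S" "S \<subseteq> vcarrier K"
    "\<And>k. k \<in> vcarrier K \<Longrightarrow> \<exists>s\<in>module.span (vscale K) S. q (k - s) = 0 \<and> k - s \<in> vcarrier K"
proof -
  interpret K: diassociative_algebra K by fact
  interpret q: Vector_Spaces.linear "vscale K" "vscale L" q by fact
  let ?S = "inv_into (vcarrier K) q ` B"
  have S: "?S \<subseteq> vcarrier K" "q ` ?S = B"
    using B_closed q(2) by (auto simp: inv_into_into f_inv_into_f image_image subset_iff)
  have "\<exists>s\<in>K.vs.span ?S. q (k - s) = 0 \<and> k - s \<in> vcarrier K" if k: "k \<in> vcarrier K" for k
  proof -
    have "q k \<in> q ` K.vs.span ?S"
      using k q(2) B(2) S(2) by (metis imageI q.span_image)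
    then obtain s where s: "s \<in> K.vs.span ?S" "q k = q s"
      by blast
    moreover have "s \<in> vcarrier K"
      using s(1) K.vs.span_minimal[OF S(1) K.subspace] by blast
    ultimately show ?thesis
      using k by (intro bexI[of _ s]) (simp_all add: q.diff K.carrier_closed)
  qed
  with S(1) B(1) show thesis
    by (intro that[of ?S]) auto
qed

text \<open>Modulo \<open>W\<close> a product in \<open>F\<close> depends on the factors modulo
  \<open>R\<close> only, so the finitely many products of lifts of \<open>B\<close> span
  \<open>F'\<close> modulo \<open>W\<close>, and \<open>g\<close> kills \<open>W\<close>.\<close>

lemma range_g_finite: "\<exists>T. finite T \<and> range g \<subseteq> F.vs.span T"
proof -
  obtain Y where Y: "finite Y" "Y \<subseteq> vcarrier F"
    "\<And>x. x \<in> vcarrier F \<Longrightarrow> \<exists>y\<in>F.vs.span Y. p (x - y) = 0 \<and> x - y \<in> vcarrier F"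
    by (rule finite_lift[OF F.diassociative_algebra_axioms p_linear p_surj]) (rule that)
  let ?P = "F.products Y Y"
  have "?P = (\<lambda>(x, y). x \<stileturn>\<^bsub>F\<^esub> y) ` (Y \<times> Y) \<union> (\<lambda>(x, y). x \<turnstile>\<^bsub>F\<^esub> y) ` (Y \<times> Y)"
    by (auto simp: F.products_def)
  then have fin: "finite ?P"
    using Y(1) by simp
  have "g z \<in> F.vs.span (g ` ?P)" if z: "z \<in> F.products (vcarrier F) (vcarrier F)" for z
  proof -
    obtain x x' where x: "x \<in> vcarrier F" "x' \<in> vcarrier F" "z = x \<stileturn>\<^bsub>F\<^esub> x' \<or> z = x \<turnstile>\<^bsub>F\<^esub> x'"
      using z by (auto simp: F.products_def)
    obtain y where y: "y \<in> F.vs.span Y" "p (x - y) = 0" "x - y \<in> vcarrier F"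
      using Y(3)[OF x(1)] by blast
    obtain y' where y': "y' \<in> F.vs.span Y" "p (x' - y') = 0" "x' - y' \<in> vcarrier F"
      using Y(3)[OF x(2)] by blast
    have c: "y \<in> vcarrier F" "y' \<in> vcarrier F"
      using y(1) y'(1) F.vs.span_minimal[OF Y(2) F.subspace] by blast+
    \<comment> \<open>Replacing \<open>x\<close> and \<open>x'\<close> by \<open>y\<close> and
      \<open>y'\<close> changes a product by products with factors in \<open>R\<close>, that is, by
      an element of \<open>W\<close>.\<close>
    have r: "x - y \<in> R" "x' - y' \<in> R"
      using y y' by (simp_all add: R_eq)
    have "x \<stileturn>\<^bsub>F\<^esub> x' = y \<stileturn>\<^bsub>F\<^esub> y' + ((x - y) \<stileturn>\<^bsub>F\<^esub> x' + y \<stileturn>\<^bsub>F\<^esub> (x' - y'))"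
      "x \<turnstile>\<^bsub>F\<^esub> x' = y \<turnstile>\<^bsub>F\<^esub> y' + ((x - y) \<turnstile>\<^bsub>F\<^esub> x' + y \<turnstile>\<^bsub>F\<^esub> (x' - y'))"
      using x(1,2) c by (simp_all add: F.product_diff)
    moreover have "g ((x - y) \<stileturn>\<^bsub>F\<^esub> x' + y \<stileturn>\<^bsub>F\<^esub> (x' - y')) = 0" "g ((x - y) \<turnstile>\<^bsub>F\<^esub> x' + y \<turnstile>\<^bsub>F\<^esub> (x' - y')) = 0"
      using products_R_in_W[OF x(2) r(1)] products_R_in_W[OF c(1) r(2)] by (simp_all add: g.add g_W)
    ultimately have "g (x \<stileturn>\<^bsub>F\<^esub> x') = g (y \<stileturn>\<^bsub>F\<^esub> y')" "g (x \<turnstile>\<^bsub>F\<^esub> x') = g (y \<turnstile>\<^bsub>F\<^esub> y')"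
      by (metis g.add add_0_right)+
    moreover have "g (y \<stileturn>\<^bsub>F\<^esub> y') \<in> F.vs.span (g ` ?P)" "g (y \<turnstile>\<^bsub>F\<^esub> y') \<in> F.vs.span (g ` ?P)"
      using F.products_span[OF Y(2,2) y(1) y'(1)] by (simp_all add: g.span_image)
    ultimately show ?thesis
      using x(3) by auto
  qed
  then have "F.products (vcarrier F) (vcarrier F) \<subseteq> {x. g x \<in> F.vs.span (g ` ?P)}"
    by blast
  moreover have "F.vs.subspace {x. g x \<in> F.vs.span (g ` ?P)}"
    by (rule g.subspace_linear_preimage) simp
  ultimately have "derived F \<subseteq> {x. g x \<in> F.vs.span (g ` ?P)}"
    unfolding F.derived_eq_span by (rule F.vs.span_minimal)
  then have "range g \<subseteq> F.vs.span (g ` ?P)"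
    unfolding g_range[symmetric] by auto
  with fin show ?thesis
    by blast
qed

text \<open>As \<open>M\<close> is central, every product in \<open>K\<close> is a product of values
  of a lift \<open>\<sigma>\<close> of \<open>p\<close>; hence \<open>\<sigma>\<close> maps
  \<open>F'\<close> onto a set containing \<open>K'\<close>, and its image of \<open>N\<close>
  contains \<open>M\<close>. Since \<open>\<sigma>\<close> kills \<open>W\<close>, it factors on
  \<open>N\<close> through \<open>g\<close>, so \<open>M\<close> lies in a linear image of
  \<open>range g\<close>. The last equation is rank-nullity for \<open>q\<close>.\<close>

lemma defining_pair_bound:
  assumes "defining_pair L K M"
  shows "\<exists>T. finite T \<and> M \<subseteq> module.span (vscale K) T"
    "vector_space.dim (vscale K) M \<le> F.vs.dim (range g)"
    "vector_space.dim (vscale K) (vcarrier K) = vector_space.dim (vscale K) M + L.vs.dim (vcarrier L)"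
proof -
  obtain q where q: "Vector_Spaces.linear (vscale K) (vscale L) q" "q \<in> dialg_hom K L"
    "q ` vcarrier K = vcarrier L" "M = {k \<in> vcarrier K. q k = 0}"
    by (rule defining_pairD[OF L.diassociative_algebra_axioms assms])
  interpret K: diassociative_algebra K
    using assms by (simp add: defining_pair_def)
  interpret q: Vector_Spaces.linear "vscale K" "vscale L" q by (rule q(1))
  interpret FK: vector_space_pair "vscale F" "vscale K" ..
  interpret KL: vector_space_pair "vscale K" "vscale L" ..
  have M: "M \<subseteq> center K" "M \<subseteq> derived K"
    using assms by (auto simp: defining_pair_def)
  obtain \<sigma> where \<sigma>: "Vector_Spaces.linear (vscale F) (vscale K) \<sigma>" "\<sigma> \<in> dialg_hom F K"
    "\<And>x. x \<in> vcarrier F \<Longrightarrow> q (\<sigma> x) = p x"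
    by (rule lift[OF K.diassociative_algebra_axioms q(2,3)]) (rule that)
  interpret \<sigma>: Vector_Spaces.linear "vscale F" "vscale K" \<sigma> by (rule \<sigma>(1))
  have \<sigma>_simps: "\<sigma> x \<in> vcarrier K" "\<sigma> (x \<stileturn>\<^bsub>F\<^esub> y) = \<sigma> x \<stileturn>\<^bsub>K\<^esub> \<sigma> y" "\<sigma> (x \<turnstile>\<^bsub>F\<^esub> y) = \<sigma> x \<turnstile>\<^bsub>K\<^esub> \<sigma> y"
    if "x \<in> vcarrier F" "y \<in> vcarrier F" for x y
    using \<sigma>(2) that
    by (simp_all add: dialg_hom_iff[OF F.diassociative_algebra_axioms K.diassociative_algebra_axioms])
  have central: "m \<stileturn>\<^bsub>K\<^esub> x = 0" "x \<stileturn>\<^bsub>K\<^esub> m = 0" "m \<turnstile>\<^bsub>K\<^esub> x = 0" "x \<turnstile>\<^bsub>K\<^esub> m = 0"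
    if "m \<in> M" "x \<in> vcarrier K" for m x
    using M(1) that by (auto simp: center_def)
  have \<sigma>R: "\<sigma> r \<in> M" if "r \<in> R" for r
    using that \<sigma>_simps(1)[of r r] \<sigma>(3)[of r] R_subset p_R by (auto simp: q(4))
  \<comment> \<open>Every element of \<open>K\<close> is a value of \<open>\<sigma>\<close> plus a
    central element, and the central part does not contribute to products.\<close>
  have split: "\<exists>x\<in>vcarrier F. \<exists>m\<in>M. k = \<sigma> x + m" if k: "k \<in> vcarrier K" for k
  proof -
    have "q k \<in> p ` vcarrier F"
      using k q(3) p_surj by blast
    then obtain x where x: "x \<in> vcarrier F" "q k = p x"
      by blast
    then have "k - \<sigma> x \<in> M"
      using k by (simp add: q(4) q.diff \<sigma>(3) K.carrier_closed \<sigma>_simps(1)[OF x(1,1)])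
    with x(1) show ?thesis
      by (intro bexI[of _ x] bexI[of _ "k - \<sigma> x"]) simp_all
  qed
  have "K.products (vcarrier K) (vcarrier K) \<subseteq> \<sigma> ` derived F"
  proof
    fix z assume "z \<in> K.products (vcarrier K) (vcarrier K)"
    then obtain a b where ab: "a \<in> vcarrier K" "b \<in> vcarrier K" "z = a \<stileturn>\<^bsub>K\<^esub> b \<or> z = a \<turnstile>\<^bsub>K\<^esub> b"
      by (auto simp: K.products_def)
    obtain x m where x: "x \<in> vcarrier F" "m \<in> M" "a = \<sigma> x + m"
      using split[OF ab(1)] by blast
    obtain y n where y: "y \<in> vcarrier F" "n \<in> M" "b = \<sigma> y + n"
      using split[OF ab(2)] by blast
    have c: "m \<in> vcarrier K" "n \<in> vcarrier K" "\<sigma> x \<in> vcarrier K" "\<sigma> y \<in> vcarrier K"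
      using x y q(4) \<sigma>_simps(1) by auto
    have "a \<stileturn>\<^bsub>K\<^esub> b = \<sigma> (x \<stileturn>\<^bsub>F\<^esub> y)" "a \<turnstile>\<^bsub>K\<^esub> b = \<sigma> (x \<turnstile>\<^bsub>F\<^esub> y)"
      using x y c by (simp_all add: K.product_simps K.carrier_closed central \<sigma>_simps)
    with ab(3) show "z \<in> \<sigma> ` derived F"
      using F.products_in_derived[OF x(1) y(1)] by auto
  qed
  then have "derived K \<subseteq> \<sigma> ` derived F"
    unfolding K.derived_eq_span
    by (rule K.vs.span_minimal[OF _ \<sigma>.subspace_image[OF F.subspace_derived]])
  have "M \<subseteq> \<sigma> ` N"
  proof
    fix m assume m: "m \<in> M"
    then obtain n where n: "n \<in> derived F" "m = \<sigma> n"
      using M(2) \<open>derived K \<subseteq> \<sigma> ` derived F\<close> by blast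
    then have "n \<in> R"
      using m q(4) \<sigma>(3)[of n] F.derived_closed by (auto simp: R_eq)
    with n show "m \<in> \<sigma> ` N"
      by blast
  qed
  have \<sigma>W: "\<sigma> w = 0" if "w \<in> W" for w
    using R_subset by (intro linear_zero_on_W[OF \<sigma>(1) _ that]) (auto simp: \<sigma>_simps central \<sigma>R subset_iff)
  obtain \<epsilon> where \<epsilon>: "Vector_Spaces.linear (vscale F) (vscale K) \<epsilon>" "\<And>n. n \<in> N \<Longrightarrow> \<epsilon> (g n) = \<sigma> n"
    by (rule linear_factor[OF g \<sigma>(1) subspace_N]) (use \<sigma>W g_kernel that in blast)+
  have M\<epsilon>: "M \<subseteq> \<epsilon> ` range g"
  proof
    fix m assume "m \<in> M"
    then obtain n where "n \<in> N" "m = \<sigma> n"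
      using \<open>M \<subseteq> \<sigma> ` N\<close> by blast
    then have "m = \<epsilon> (g n)"
      using \<epsilon>(2) by simp
    then show "m \<in> \<epsilon> ` range g"
      by blast
  qed
  obtain T where T: "finite T" "range g \<subseteq> F.vs.span T"
    using range_g_finite by blast
  show "K.vs.dim M \<le> F.vs.dim (range g)" and ex: "\<exists>T. finite T \<and> M \<subseteq> K.vs.span T"
    using FK.dim_image_le[OF \<epsilon>(1) T M\<epsilon>] by blast+
  obtain T' where T': "finite T'" "M \<subseteq> K.vs.span T'"
    using ex by blast
  obtain S where S: "finite S" "S \<subseteq> vcarrier K"
    "\<And>k. k \<in> vcarrier K \<Longrightarrow> \<exists>s\<in>K.vs.span S. q (k - s) = 0 \<and> k - s \<in> vcarrier K"
    by (rule finite_lift[OF K.diassociative_algebra_axioms q(1,3)]) (rule that)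
  \<comment> \<open>Lifts of \<open>B\<close> and a finite spanning set of \<open>M\<close> together
    span \<open>K\<close>; rank-nullity needs such a finite set.\<close>
  have "vcarrier K \<subseteq> K.vs.span (S \<union> T')"
  proof
    fix k assume "k \<in> vcarrier K"
    then obtain s where s: "s \<in> K.vs.span S" "k - s \<in> M"
      using S(3) q(4) by blast
    then have "s + (k - s) \<in> K.vs.span (S \<union> T')"
      using T'(2) unfolding K.vs.span_Un by blast
    then show "k \<in> K.vs.span (S \<union> T')"
      by simp
  qed
  then show "K.vs.dim (vcarrier K) = K.vs.dim M + L.vs.dim (vcarrier L)"
    using KL.dim_eq_kernel_plus_image[OF q(1) K.subspace, of "S \<union> T'"] S(1) T'(1) q(3,4) by simp
qed

end

end

end

context linear_free_presentation
begin

section \<open>Existence of maximal defining pairs and their comparison with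
  \<open>H2\<close>\<close>

context
  fixes g :: "'a \<Rightarrow> 'a" and B :: "'l set"
  assumes g: "Vector_Spaces.linear (vscale F) (vscale F) g"
    and g_range: "g ` N = range g" and g_kernel: "{n \<in> N. g n = 0} = W"
    and B: "finite B" "vcarrier L = L.vs.span B"
begin

interpretation g: Vector_Spaces.linear "vscale F" "vscale F" g
  by (rule g)

lemmas bound = defining_pair_bound[OF g g_range g_kernel B]

text \<open>\<open>K\<close> is a copy of the image of \<open>F\<close> under the map to
  \<open>(p x, g x)\<close>, that is, of \<open>F / S\<close> with \<open>S\<close> the common
  kernel of \<open>p\<close> and \<open>g\<close> on \<open>F\<close>. Then \<open>S\<close> meets
  \<open>N\<close> in \<open>W\<close>, and \<open>g\<close> takes the same values on
  \<open>N\<close> as everywhere, so \<open>R = N + S\<close>: thus \<open>S / W\<close> is a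
  complement of \<open>N / W\<close> in \<open>R / W\<close>.\<close>

lemma defining_pair_attaining_bound:
  "\<exists>(K :: ('f, nat \<Rightarrow> 'f) dialgebra) M. defining_pair L K M \<and>
     vector_space.dim (vscale K) M = F.vs.dim (range g)"
proof -
  obtain T where T: "finite T" "range g \<subseteq> F.vs.span T"
    using range_g_finite[OF g g_range g_kernel B] by blast
  interpret P: vector_space "prod_scale (vscale L) (vscale F)"
    by (rule vector_space_prod_scale[OF L.vector_space F.vector_space])
  define \<sigma>0 where "\<sigma>0 x = (p x, g x)" for x
  have \<sigma>0: "Vector_Spaces.linear (vscale F) (prod_scale (vscale L) (vscale F)) \<sigma>0"
    by (simp add: Vector_Spaces.linear_iff F.vector_space P.vector_space_axioms \<sigma>0_def
        p.add p.scale g.add g.scale prod_scale_def)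
  have inl: "Vector_Spaces.linear (vscale L) (prod_scale (vscale L) (vscale F)) (\<lambda>l. (l, 0))"
    and inr: "Vector_Spaces.linear (vscale F) (prod_scale (vscale L) (vscale F)) (\<lambda>x. (0, x))"
    by (simp_all add: Vector_Spaces.linear_iff F.vector_space L.vector_space P.vector_space_axioms
        prod_scale_def)
  let ?U = "(\<lambda>l. (l, 0)) ` B \<union> (\<lambda>x. (0, x)) ` T"
  have V: "\<sigma>0 ` vcarrier F \<subseteq> P.span ?U"
  proof (intro subsetI, elim imageE, hypsubst)
    fix x assume "x \<in> vcarrier F"
    then have "p x \<in> L.vs.span B" "g x \<in> F.vs.span T"
      using B(2) T(2) p_simps(1) by auto
    then have "(p x, 0) \<in> P.span ((\<lambda>l. (l, 0)) ` B)" "(0, g x) \<in> P.span ((\<lambda>x. (0, x)) ` T)"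
      using Vector_Spaces.linear.axioms(3)[OF inl, THEN module_hom.span_image, of B]
        Vector_Spaces.linear.axioms(3)[OF inr, THEN module_hom.span_image, of T] by auto
    then have "(p x, 0) + (0, g x) \<in> P.span ?U"
      unfolding P.span_Un by blast
    then show "\<sigma>0 x \<in> P.span ?U"
      by (simp add: \<sigma>0_def)
  qed
  \<comment> \<open>Listing the finite spanning set indexes it by natural numbers, so that
    coordinates place the image in \<open>nat \<Rightarrow> 'f\<close>.\<close>
  have "\<exists>us. set us = ?U"
    using B(1) T(1) by (intro finite_list) simp
  then obtain us where us: "set us = ?U"
    by (rule exE)
  have "?U \<subseteq> range (\<lambda>n. us ! n)"
    unfolding us[symmetric] by (metis in_set_conv_nth rangeI subsetI)
  then have "\<sigma>0 ` vcarrier F \<subseteq> P.span (range (\<lambda>n. us ! n))"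
    using V P.span_mono by blast
  then obtain \<iota> where \<iota>: "Vector_Spaces.linear (prod_scale (vscale L) (vscale F))
      (fun_scale :: 'f \<Rightarrow> (nat \<Rightarrow> 'f) \<Rightarrow> _) \<iota>" "inj_on \<iota> (\<sigma>0 ` vcarrier F)"
    by (rule P.exists_coordinates)
  interpret \<iota>: Vector_Spaces.linear "prod_scale (vscale L) (vscale F)" fun_scale \<iota> by (rule \<iota>(1))
  interpret \<sigma>0: Vector_Spaces.linear "vscale F" "prod_scale (vscale L) (vscale F)" \<sigma>0 by (rule \<sigma>0)
  define \<sigma> where "\<sigma> x = \<iota> (\<sigma>0 x)" for x
  have \<sigma>: "Vector_Spaces.linear (vscale F) fun_scale \<sigma>"
    by (simp add: Vector_Spaces.linear_iff F.vector_space vector_space_fun_scale \<sigma>_def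
        \<sigma>0.add \<sigma>0.scale \<iota>.add \<iota>.scale)
  interpret \<sigma>: Vector_Spaces.linear "vscale F" fun_scale \<sigma> by (rule \<sigma>)
  interpret F\<sigma>: vector_space_pair "fun_scale :: 'f \<Rightarrow> (nat \<Rightarrow> 'f) \<Rightarrow> _" "vscale F" ..
  have \<sigma>_0: "\<sigma> x = 0 \<longleftrightarrow> p x = 0 \<and> g x = 0" if "x \<in> vcarrier F" for x
  proof -
    have "\<sigma> x = 0 \<longleftrightarrow> \<iota> (\<sigma>0 x) = \<iota> (\<sigma>0 0)"
      by (simp add: \<sigma>_def \<sigma>0.zero \<iota>.zero)
    also have "\<dots> \<longleftrightarrow> \<sigma>0 x = \<sigma>0 0"
      by (rule inj_on_eq_iff[OF \<iota>(2) imageI[OF that] imageI[OF F.carrier_closed(1)]])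
    finally show ?thesis
      by (simp add: \<sigma>0.zero) (simp add: \<sigma>0_def zero_prod_def)
  qed
  have \<sigma>_W: "\<sigma> w = 0" if "w \<in> W" for w
    using that W_subset_N R_subset p_R g_W[OF g g_range g_kernel that] by (subst \<sigma>_0) auto
  have \<sigma>_R: "\<sigma> (x \<stileturn>\<^bsub>F\<^esub> r) = 0" "\<sigma> (x \<turnstile>\<^bsub>F\<^esub> r) = 0" "\<sigma> (r \<stileturn>\<^bsub>F\<^esub> x) = 0" "\<sigma> (r \<turnstile>\<^bsub>F\<^esub> x) = 0"
    if "r \<in> R" "x \<in> vcarrier F" for x r
    using products_R_in_W[OF that(2,1)] \<sigma>_W by blast+
  \<comment> \<open>An element of \<open>F\<close> killed by \<open>\<sigma>\<close> lies in
    \<open>R\<close>; its products lie in \<open>W\<close>, which \<open>\<sigma>\<close>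
    kills.\<close>
  have ideal: "\<sigma> (x \<stileturn>\<^bsub>F\<^esub> y) = 0 \<and> \<sigma> (y \<stileturn>\<^bsub>F\<^esub> x) = 0 \<and> \<sigma> (x \<turnstile>\<^bsub>F\<^esub> y) = 0 \<and> \<sigma> (y \<turnstile>\<^bsub>F\<^esub> x) = 0"
    if "x \<in> vcarrier F" "y \<in> vcarrier F" "\<sigma> x = 0" for x y
    using that \<sigma>_R[of x y] \<sigma>_0[of x] by (simp add: R_eq)
  let ?K = "pushforward fun_scale \<sigma> F" and ?M = "\<sigma> ` R"
  have K: "diassociative_algebra ?K" "\<sigma> \<in> dialg_hom F ?K"
    by (rule F.pushforward_algebra[OF \<sigma> ideal] F.pushforward_hom[OF \<sigma> ideal]; assumption)+
  interpret K: diassociative_algebra ?K by (rule K(1))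
  note prod = F.pushforward_products[OF \<sigma> ideal]
  obtain q where q: "Vector_Spaces.linear fun_scale (vscale L) q" "\<And>x. x \<in> vcarrier F \<Longrightarrow> q (\<sigma> x) = p x"
    by (rule linear_factor[OF \<sigma> p_linear F.subspace]) (use \<sigma>_0 that in blast)+
  interpret q: Vector_Spaces.linear fun_scale "vscale L" q by (rule q(1))
  have q_hom: "q \<in> dialg_hom ?K L"
    unfolding dialg_hom_iff[OF K(1) L.diassociative_algebra_axioms] pushforward_simps ball_simps
    by (intro conjI allI ballI)
      (simp_all add: q(2) p_simps prod F.lprod_closed F.rprod_closed q.scale q.add)
  have q_surj: "q ` vcarrier ?K = vcarrier L"
    using p_surj q(2) by (auto simp: image_image)
  have M_kernel: "?M = {k \<in> vcarrier ?K. q k = 0}"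
    using q(2) by (auto simp: R_eq)
  have M_center: "?M \<subseteq> center ?K"
    using R_subset by (auto simp: center_def prod \<sigma>_R subset_iff)
  \<comment> \<open>For \<open>r\<close> in \<open>R\<close> some \<open>n\<close> in
    \<open>N\<close> has the same \<open>g\<close>-value; as \<open>p\<close> kills both,
    \<open>\<sigma>\<close> identifies them. So \<open>R\<close> may be replaced by
    \<open>N\<close>, whose image lies in \<open>K'\<close>.\<close>
  have M_eq: "?M = \<sigma> ` N"
  proof (intro equalityI subsetI)
    fix m assume "m \<in> ?M"
    then obtain r where r: "r \<in> R" "m = \<sigma> r"
      by blast
    obtain n where n: "n \<in> N" "g r = g n"
      using g_range by (metis imageE rangeI)
    then have "\<sigma> r = \<sigma> n"
      using r(1) p_R by (simp add: \<sigma>_def \<sigma>0_def)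
    with r(2) n(1) show "m \<in> \<sigma> ` N"
      by blast
  qed blast
  have "\<sigma> ` derived F \<subseteq> derived ?K"
  proof -
    have "\<sigma> ` F.products (vcarrier F) (vcarrier F) \<subseteq> K.products (vcarrier ?K) (vcarrier ?K)"
      by (auto simp: F.products_def K.productsI simp flip: prod)
    then show ?thesis
      unfolding F.derived_eq_span K.derived_eq_span \<sigma>.span_image[symmetric]
      using K.vs.span_mono by simp
  qed
  then have "?M \<subseteq> derived ?K"
    unfolding M_eq by blast
  then have pair: "defining_pair L ?K ?M"
    by (rule defining_pairI[OF K(1) L.diassociative_algebra_axioms q_hom q_surj M_kernel M_center])
  \<comment> \<open>On \<open>N\<close>, \<open>g\<close> is recovered from \<open>\<sigma>\<close>,
    so \<open>range g\<close> is a linear image of \<open>M\<close> and its dimension is at most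
    that of \<open>M\<close>.\<close>
  obtain \<epsilon> where \<epsilon>: "Vector_Spaces.linear fun_scale (vscale F) \<epsilon>" "\<And>n. n \<in> N \<Longrightarrow> \<epsilon> (\<sigma> n) = g n"
    by (rule linear_factor[OF \<sigma> g subspace_N]) (use \<sigma>_0 R_subset that in blast)+
  have "range g \<subseteq> \<epsilon> ` ?M"
    unfolding g_range[symmetric] M_eq using \<epsilon>(2) by (auto simp: image_image)
  moreover obtain T' where "finite T'" "?M \<subseteq> K.vs.span T'"
    using bound(1)[OF pair] by blast
  ultimately have "F.vs.dim (range g) \<le> K.vs.dim ?M"
    using F\<sigma>.dim_image_le(1)[OF \<epsilon>(1)] by simp
  then have "K.vs.dim ?M = F.vs.dim (range g)"
    using bound(2)[OF pair] by simp
  with pair show ?thesis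
    by blast
qed

text \<open>The dimensions of \<open>K\<close> and \<open>M\<close> differ by that of
  \<open>L\<close>, so a pair whose \<open>M\<close> attains the bound is maximal.\<close>

lemma maximal_defining_pair_exists:
  "\<exists>(K :: ('f, nat \<Rightarrow> 'f) dialgebra) M. maximal_defining_pair L K M"
proof -
  obtain K :: "('f, nat \<Rightarrow> 'f) dialgebra" and M where K: "defining_pair L K M"
    "vector_space.dim (vscale K) M = F.vs.dim (range g)"
    using defining_pair_attaining_bound by blast
  have "vector_space.dim (vscale K') (vcarrier K') \<le> vector_space.dim (vscale K) (vcarrier K)"
    if "defining_pair L K' M'" for K' :: "('f, nat \<Rightarrow> 'f) dialgebra" and M'
    using bound(2,3)[OF that] bound(3)[OF K(1)] K(2) by simp
  with K(1) show ?thesis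
    unfolding maximal_defining_pair_def by blast
qed

text \<open>Comparison with a pair attaining the bound gives \<open>M\<close> the dimension of
  \<open>range g\<close>, which is isomorphic to \<open>H2 L\<close>.\<close>

lemma multiplier_iso:
  assumes "maximal_defining_pair L K M"
  shows "vs_iso (subvspace (vscale K) M) (H2 L)"
proof -
  have pair: "defining_pair L K M"
    using assms by (simp add: maximal_defining_pair_def)
  interpret K: diassociative_algebra K
    using pair by (simp add: defining_pair_def)
  obtain K' :: "('f, nat \<Rightarrow> 'f) dialgebra" and M' where K': "defining_pair L K' M'"
    "vector_space.dim (vscale K') M' = F.vs.dim (range g)"
    using defining_pair_attaining_bound by blast
  have "vector_space.dim (vscale K') (vcarrier K') \<le> K.vs.dim (vcarrier K)"
    using assms K'(1) unfolding maximal_defining_pair_def by blast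
  then have dim: "K.vs.dim M = F.vs.dim (range g)"
    using bound(2,3)[OF pair] bound(3)[OF K'(1)] K'(2) by simp
  obtain T where T: "finite T" "range g \<subseteq> F.vs.span T"
    using range_g_finite[OF g g_range g_kernel B] by blast
  obtain T' where T': "finite T'" "M \<subseteq> K.vs.span T'"
    using bound(1)[OF pair] by blast
  have "K.vs.subspace M"
    using pair by (simp add: defining_pair_def)
  then have "vs_iso (subvspace (vscale K) M) (subvspace (vscale F) (range g))"
    using K.vs.subvspace_iso_of_dim_eq[OF F.vector_space _ subspace_range_g[OF g g_range g_kernel] T' T dim]
    by blast
  then show ?thesis
    using vs_iso_trans vs_iso_sym[OF H2_iso_range[OF g g_range g_kernel T] vs_closed_H2] by blast
qed

end

end

text \<open>A free presentation involves \<open>p\<close> only on the carrier of \<open>F\<close>,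
  so \<open>p\<close> may be exchanged for a linear extension of its restriction.\<close>

lemma free_presentation_linear:
  assumes "free_presentation R F p L"
  obtains p' where "linear_free_presentation R F p' L"
proof -
  interpret L: diassociative_algebra L
    using assms by (simp add: free_presentation_def)
  interpret F: diassociative_algebra F
    using assms by (simp add: free_presentation_def free_dialgebra_def)
  have p: "p \<in> dialg_hom F L"
    using assms by (simp add: free_presentation_def)
  obtain p' where p': "Vector_Spaces.linear (vscale F) (vscale L) p'"
    "\<And>x. x \<in> vcarrier F \<Longrightarrow> p' x = p x" "p' \<in> dialg_hom F L"
    by (rule F.hom_linear_extension[OF L.diassociative_algebra_axioms p]) (rule that)
  have "p' ` vcarrier F = p ` vcarrier F" "{x \<in> vcarrier F. p' x = 0} = {x \<in> vcarrier F. p x = 0}"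
    using p'(2) by auto
  then have "free_presentation R F p' L"
    using assms p'(3) by (simp add: free_presentation_def)
  with p'(1) that show thesis
    by (simp add: linear_free_presentation_def)
qed

text \<open>An infinite-dimensional space is not isomorphic to its dual, so the general statement
  has the dual of the quotient; the quotient itself appears when it is finite-dimensional, in
  particular for finite-dimensional \<open>L\<close>. The multiplier clause consists of existence on
  \<open>nat \<Rightarrow> 'f\<close> and of the isomorphism for maximal pairs on any type.\<close>

theorem theorem3p6:
  fixes L :: "('f::field, 'l::ab_group_add) dialgebra"
    and F :: "('f, 'a::ab_group_add) dialgebra"
    and R :: "'a set"
    and p :: "'a \<Rightarrow> 'l"
  assumes "diassociative_algebra L"
    and "free_presentation R F p L"
  shows "vs_iso (H2 L) (dual_space (hopf_quotient F R)) \<and>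
    (vs_findim (hopf_quotient F R) \<longrightarrow> vs_iso (H2 L) (hopf_quotient F R)) \<and>
    (vs_findim L \<longrightarrow>
       vs_iso (H2 L) (hopf_quotient F R) \<and>
       (\<exists>(K :: ('f, nat \<Rightarrow> 'f) dialgebra) M. maximal_defining_pair L K M) \<and>
       (\<forall>(K :: ('f, 'k::ab_group_add) dialgebra) M. maximal_defining_pair L K M \<longrightarrow>
          vs_iso (subvspace (vscale K) M) (H2 L)))"
proof -
  obtain p' where "linear_free_presentation R F p' L"
    using assms(2) by (rule free_presentation_linear)
  then interpret linear_free_presentation R F p' L .
  obtain g where g: "Vector_Spaces.linear (vscale F) (vscale F) g" "g ` N = range g"
    "{x \<in> N. g x = 0} = W"
    by (rule F.vs.exists_linear_with_kernel[OF subspace_W subspace_N W_subset_N])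
  have "vs_iso (H2 L) (hopf_quotient F R) \<and>
       (\<exists>(K :: ('f, nat \<Rightarrow> 'f) dialgebra) M. maximal_defining_pair L K M) \<and>
       (\<forall>(K :: ('f, 'k) dialgebra) M. maximal_defining_pair L K M \<longrightarrow>
          vs_iso (subvspace (vscale K) M) (H2 L))" if findim: "vs_findim L"
  proof -
    obtain B where B: "finite B" "vcarrier L = L.vs.span B"
      using findim vs_findim_iff_finite_span[OF L.vector_space L.vplus_eq L.subspace] by blast
    have "vs_findim (hopf_quotient F R)"
      using hopf_quotient_findim_iff[OF g] range_g_finite[OF g B] by blast
    then show ?thesis
      using H2_iso_hopf_quotient[OF g] maximal_defining_pair_exists[OF g B]
        multiplier_iso[OF g B] by blast
  qed
  then show ?thesis
    using H2_iso_dual H2_iso_hopf_quotient[OF g] by blast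
qed

end
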